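(* Let $d\ge1$ and let $f$ and $g$ be nonzero polynomials in $\mathbb{C}[\mathbb{Z}^d]$. Then $\mathsf{D}_{fg}=\mathsf{D}_f\circledast\mathsf{D}_g$ as functions on $\mathbb{R}^d$, where $\mathsf{D}_f,\mathsf{D}_g,\mathsf{D}_{fg}$ are the decimation limits and $\circledast$ is tropical convolution.
   Context: $\mathbb{C}[\mathbb{Z}^d]$ is identified with the ring of complex Laurent polynomials in $d$ commuting variables: $f(\mathbf{x})=\sum_{\mathbf{n}\in\mathbb{Z}^d}\widehat{f}(\mathbf{n})\mathbf{x}^{\mathbf{n}}$, a finite sum. $\operatorname{supp} f=\{\mathbf{n}:\widehat{f}(\mathbf{n})\neq0\}$, and the Newton polytope $\mathcal{N}_f$ is the convex hull of $\operatorname{supp} f$ in $\mathbb{R}^d$. The coefficient function $\widehat f$ is extended from $\mathbb{Z}^d$ to $\mathbb{R}^d$ by $0$ off $\operatorname{supp} f$. For $N\ge1$ the $N$th decimation of $f$ is $f_{\langle N\rangle}(x_1,\dots,x_d)=\prod_{k_1=0}^{N-1}\cdots\prod_{k_d=0}^{N-1} f(e^{2\pi i k_1/N}x_1,\dots,e^{2\pi i k_d/N}x_d)$. Put $(\mathsf{L}_N f)(\mathbf{r})=\frac{1}{N^d}\log|\widehat{f_{\langle N\rangle}}(N^d\mathbf{r})|$ for $\mathbf{r}\in\mathbb{R}^d$ (with $\log0=-\infty$), and let $\mathsf{D}_N f$ be the concave hull of $\mathsf{L}_N f$, i.e. the infimum of all affine functions on $\mathbb{R}^d$ dominating $\mathsf{L}_N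 f$. For $f\ne0$ the functions $\mathsf{D}_N f$ converge uniformly on $\mathcal{N}_f$ as $N\to\infty$ to a continuous concave function; this limit is the decimation limit $\mathsf{D}_f$, extended to $\mathbb{R}^d$ by $\mathsf{D}_f=-\infty$ off $\mathcal{N}_f$. For functions $\phi,\psi\colon\mathbb{R}^d\to\mathbb{R}\cup\{-\infty\}$ with finite supremum, their tropical convolution is $(\phi\circledast\psi)(\mathbf{r})=\sup\{\phi(\mathbf{s})+\psi(\mathbf{r}-\mathbf{s}):\mathbf{s}\in\mathbb{R}^d\}$. *)

theory Defs
  imports "HOL-Analysis.Analysis" "HOL-Library.Poly_Mapping"
begin

text \<open>
  The ring \<open>\<complex>[\<int>\<^sup>d]\<close> is the type \<open>(int ^ 'd) \<Rightarrow>\<^sub>0 complex\<close> with \<open>d = CARD('d)\<close>. The product of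
  \<^theory>\<open>HOL-Library.Poly_Mapping\<close> is convolution of coefficient functions, that is, multiplication
  of Laurent polynomials.
\<close>

type_synonym 'd laurent = "(int ^ 'd) \<Rightarrow>\<^sub>0 complex"

definition newton_polytope :: "'d::finite laurent \<Rightarrow> (real ^ 'd) set" where
  "newton_polytope f = convex hull ((\<lambda>n. \<chi> i. real_of_int (n $ i)) ` Poly_Mapping.keys f)"

definition coeff_real :: "'d::finite laurent \<Rightarrow> real ^ 'd \<Rightarrow> complex" where
  "coeff_real f r =
     (if \<forall>i. r $ i \<in> \<int> then Poly_Mapping.lookup f (\<chi> i. \<lfloor>r $ i\<rfloor>) else 0)"

text \<open>
  The polynomial \<open>f (c\<^sub>1 x\<^sub>1, \<dots>, c\<^sub>d x\<^sub>d)\<close>: substituting \<open>c\<^sub>i x\<^sub>i\<close> for \<open>x\<^sub>i\<close> multiplies the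
  coefficient of \<open>x\<^sup>n\<close> by \<open>c\<^sup>n\<close>.
\<close>

definition rescale_vars :: "complex ^ 'd \<Rightarrow> 'd::finite laurent \<Rightarrow> 'd laurent" where
  "rescale_vars c f = Poly_Mapping.mapp (\<lambda>n a. a * (\<Prod>i\<in>UNIV. (c $ i) powi (n $ i))) f"

definition decimation :: "nat \<Rightarrow> 'd::finite laurent \<Rightarrow> 'd laurent" where
  "decimation N f =
     (\<Prod>k\<in>{k :: nat ^ 'd. \<forall>i. k $ i < N}.
        rescale_vars (\<chi> i. exp (2 * of_real pi * \<i> * of_nat (k $ i) / of_nat N)) f)"

definition log_norm :: "complex \<Rightarrow> ereal" where
  "log_norm z = (if z = 0 then -\<infinity> else ereal (ln (cmod z)))"

definition decimation_log :: "nat \<Rightarrow> 'd::finite laurent \<Rightarrow> real ^ 'd \<Rightarrow> ereal" where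
  "decimation_log N f r =
     ereal (1 / real N ^ CARD('d)) *
       log_norm (coeff_real (decimation N f) (real N ^ CARD('d) *\<^sub>R r))"

definition concave_hull :: "('a::euclidean_space \<Rightarrow> ereal) \<Rightarrow> 'a \<Rightarrow> ereal" where
  "concave_hull \<phi> r = (INF (a, b)\<in>{(a, b). \<forall>s. \<phi> s \<le> ereal (a \<bullet> s + b)}. ereal (a \<bullet> r + b))"

text \<open>
  For \<open>f \<noteq> 0\<close> the convergence is uniform on the Newton polytope, so the limit function can be
  taken pointwise.
\<close>

definition decimation_limit :: "'d::finite laurent \<Rightarrow> real ^ 'd \<Rightarrow> ereal" where
  "decimation_limit f r =
     (if r \<in> newton_polytope f then lim (\<lambda>N. concave_hull (decimation_log N f) r) else -\<infinity>)"

text \<open>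
  Intended for \<open>\<phi>\<close> and \<open>\<psi>\<close> that do not take the value \<open>\<infinity>\<close>, so that
  no sum \<open>\<infinity> + (-\<infinity>)\<close> occurs.
\<close>

definition tropical_conv ::
    "('a::ab_group_add \<Rightarrow> ereal) \<Rightarrow> ('a \<Rightarrow> ereal) \<Rightarrow> 'a \<Rightarrow> ereal" (infixl "\<circledast>" 70) where
  "(\<phi> \<circledast> \<psi>) r = (SUP s. \<phi> s + \<psi> (r - s))"

end

theory Submission
  imports Defs
    "HOL-Complex_Analysis.Conformal_Mappings"
    "HOL-Computational_Algebra.Fundamental_Theorem_Algebra"
begin

text \<open>
  For \<open>u \<in> \<real>\<^sup>d\<close> let \<open>h\<^sub>u p\<close> be the maximum of \<open>log \<bar>p\<^sub>n\<bar> + u \<bullet> n\<close> over the exponents \<open>n\<close> of \<open>p\<close>.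
  Up to the sign of \<open>u\<close>, the function \<open>u \<mapsto> N\<^sup>-\<^sup>d h\<^sub>u f\<^sub>N\<close>, with \<open>f\<^sub>N\<close> the \<open>N\<close>th decimation, is the Legendre
  dual of the concave hull in the definition of the decimation limit. Sums of Legendre duals
  correspond to tropical convolutions, so the theorem says that \<open>N\<^sup>-\<^sup>d h\<^sub>u f\<^sub>N\<close> has a limit which is
  additive in \<open>f\<close> under multiplication.

  The decimation itself is multiplicative, but \<open>h\<^sub>u\<close> is not: coefficients of a product can cancel.
  Gelfond's inequality bounds this effect. For any finite family of nonzero Laurent
  polynomials, \<open>h\<^sub>u (\<Prod> p\<^sub>i)\<close> and \<open>\<Sum> h\<^sub>u p\<^sub>i\<close> differ by at most a constant times the sum of
  the widths of the \<open>p\<^sub>i\<close>, that is, of the lengths of the exponent ranges. The constant is independent of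
  \<open>u\<close> and of the number of factors (\<open>gelfond_inequality\<close>). What makes this
  sharp enough is that \<open>f\<^sub>N\<close> is a Laurent polynomial in \<open>x\<^sub>1\<^sup>N, \<dots>, x\<^sub>d\<^sup>N\<close>: its width in these
  variables is only of order \<open>N\<^sup>d\<^sup>-\<^sup>1\<close>, and after division by \<open>N\<^sup>d\<close> the error is of order \<open>1/N\<close>.

  Two applications of the inequality carry the analysis. The decimation of order \<open>N M\<close> is a
  product of \<open>M\<^sup>d\<close> rotated copies of the decimation of order \<open>N\<close>, and rotations do not change
  \<open>h\<^sub>u\<close>; hence \<open>N\<^sup>-\<^sup>d h\<^sub>u f\<^sub>N\<close> is a Cauchy sequence, uniformly in \<open>u\<close> (\<open>decimated_height_multiple\<close>).
  And the decimation of \<open>f g\<close> is a product of two factors, so the limit, the Ronkin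
  function of \<open>f\<close>, is additive (\<open>ronkin_mult\<close>).

  It follows that the decimation limit is the concave Legendre dual of the Ronkin function on all
  of \<open>\<real>\<^sup>d\<close>; off the Newton polytope both are \<open>-\<infinity>\<close> (\<open>decimation_limit_eq_ronkin_dual\<close>). That the dual
  of a sum is at least the tropical convolution of the duals is immediate. The reverse inequality
  is proved at a finite level \<open>N\<close>, where the functions are dual to finite point sets and
  convex hulls commute with Minkowski sums (\<open>split_upper_support_sum\<close>); the error in passing to
  level \<open>N\<close> tends to zero.
\<close>

section \<open>Large values on the unit circle\<close>

text \<open>
  Reflecting every root \<open>a\<close> of \<open>p\<close> in the closed unit disc across the unit circle, by replacing \<open>x - a\<close> with
  \<open>1 - cnj a x\<close>, does not change the modulus on the unit circle and makes the constant
  coefficient as large as the Mahler measure of \<open>p\<close>. Each linear factor at most doubles the ratio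
  between the coefficients and this measure.
\<close>

lemma circle_reflection:
  fixes p :: "complex poly"
  assumes "p \<noteq> 0"
  shows "\<exists>q. (\<forall>z. cmod z = 1 \<longrightarrow> cmod (poly q z) = cmod (poly p z)) \<and>
             (\<forall>k. cmod (coeff p k) \<le> 2 ^ degree p * cmod (poly q 0))"
  using assms
proof (induction "degree p" arbitrary: p)
  case 0
  then obtain c where p: "p = [:c:]"
    by (metis degree_eq_zeroE)
  show ?case
    by (rule exI[of _ p]) (auto simp: p coeff_pCons split: nat.split)
next
  case (Suc n)
  have "\<not> constant (poly p)"
    using Suc.hyps(2) by (simp add: constant_degree)
  then obtain a where "poly p a = 0"
    using fundamental_theorem_of_algebra by blast
  then obtain r where r: "p = [:- a, 1:] * r"
    using poly_eq_0_iff_dvd by (metis dvdE)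
  have r0: "r \<noteq> 0" using Suc.prems r by auto
  have deg: "degree p = Suc (degree r)"
    unfolding r using r0 by (subst degree_mult_eq) auto
  from Suc.hyps(1)[of r] Suc.hyps(2) deg r0 obtain q where
    q: "\<And>z. cmod z = 1 \<Longrightarrow> cmod (poly q z) = cmod (poly r z)"
       "\<And>k. cmod (coeff r k) \<le> 2 ^ degree r * cmod (poly q 0)"
    by auto
  define l where "l = (if cmod a \<le> 1 then [:1, - cnj a:] else [:- a, 1:])"
  have l1: "cmod (poly l z) = cmod (z - a)" if "cmod z = 1" for z
  proof (cases "cmod a \<le> 1")
    case True
    \<comment> \<open>On the circle \<open>cnj z\<close> is the inverse of \<open>z\<close>.\<close>
    have "cmod (z - a) = cmod (cnj z * (z - a))"
      using that by (simp add: norm_mult)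
    also have "cnj z * (z - a) = 1 - cnj z * a"
      using that by (simp add: algebra_simps complex_norm_square[symmetric] mult.commute[of "cnj z" z])
    also have "cmod \<dots> = cmod (cnj (1 - cnj z * a))"
      by (simp only: complex_mod_cnj)
    also have "cnj (1 - cnj z * a) = 1 - z * cnj a"
      by simp
    finally show ?thesis using True by (simp add: l_def)
  qed (simp add: l_def)
  have l2: "cmod (poly l 0) \<ge> 1" "cmod (poly l 0) \<ge> cmod a"
    by (auto simp: l_def)
  show ?case
  proof (intro exI[of _ "l * q"] conjI allI impI)
    fix z :: complex assume "cmod z = 1"
    then show "cmod (poly (l * q) z) = cmod (poly p z)"
      by (simp add: r norm_mult l1 q(1) flip: left_diff_distrib)
  next
    fix k
    define Q where "Q = 2 ^ degree r * cmod (poly q 0)"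
    have Q0: "Q \<ge> 0" by (simp add: Q_def)
    have "coeff p k = (case k of 0 \<Rightarrow> 0 | Suc i \<Rightarrow> coeff r i) - a * coeff r k"
      unfolding r by (simp add: coeff_pCons split: nat.split)
    then have "cmod (coeff p k) \<le> cmod (case k of 0 \<Rightarrow> 0 | Suc i \<Rightarrow> coeff r i) + cmod a * cmod (coeff r k)"
      by (metis norm_mult norm_triangle_ineq4)
    also have "\<dots> \<le> Q + cmod a * Q"
      using q(2) Q0 by (intro add_mono mult_left_mono) (auto simp: Q_def[symmetric] split: nat.split)
    also have "\<dots> \<le> cmod (poly l 0) * Q + cmod (poly l 0) * Q"
      using l2 Q0 by (intro add_mono mult_right_mono) (auto simp: mult_le_cancel_right1)
    also have "\<dots> = 2 ^ degree p * cmod (poly (l * q) 0)"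
      by (simp add: deg Q_def norm_mult)
    finally show "cmod (coeff p k) \<le> 2 ^ degree p * cmod (poly (l * q) 0)" .
  qed
qed

lemma poly_maximum_modulus:
  fixes q :: "complex poly"
  shows "\<exists>z. cmod z = 1 \<and> cmod (poly q 0) \<le> cmod (poly q z)"
proof -
  have "\<exists>z\<in>sphere 0 1. \<forall>y\<in>sphere 0 1. cmod (poly q y) \<le> cmod (poly q z)"
    by (rule continuous_attains_sup) (auto intro!: continuous_intros)
  then obtain z :: complex where z: "cmod z = 1" "\<And>y. cmod y = 1 \<Longrightarrow> cmod (poly q y) \<le> cmod (poly q z)"
    by auto
  have "cmod (poly q 0) \<le> cmod (poly q z)"
    by (rule maximum_modulus_frontier[of "poly q" "cball 0 1"])
       (auto intro!: holomorphic_intros continuous_intros z(2) simp: dist_norm frontier_cball)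
  with z(1) show ?thesis by blast
qed

text \<open>
  The reflected polynomials multiply, so one point of the circle at which the modulus of their
  product is maximal serves the whole family at once. This is why the constant does not depend on
  the number of factors.
\<close>

lemma simultaneous_large_values:
  fixes p :: "'i \<Rightarrow> complex poly"
  assumes "finite I" and deg: "\<And>i. i \<in> I \<Longrightarrow> degree (p i) \<le> w i"
  shows "\<exists>z. cmod z = 1 \<and>
           (\<Prod>i\<in>I. cmod (coeff (p i) (k i))) \<le> 2 ^ (\<Sum>i\<in>I. w i) * (\<Prod>i\<in>I. cmod (poly (p i) z))"
proof (cases "\<exists>i\<in>I. p i = 0")
  case True
  then have "(\<Prod>i\<in>I. cmod (coeff (p i) (k i))) = 0"
    using assms(1) by (auto simp: prod_zero_iff) (metis coeff_0)
  then show ?thesis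
    by (intro exI[of _ 1]) (simp add: prod_nonneg)
next
  case False
  then have "\<forall>i\<in>I. \<exists>q. (\<forall>z. cmod z = 1 \<longrightarrow> cmod (poly q z) = cmod (poly (p i) z)) \<and>
             (\<forall>k. cmod (coeff (p i) k) \<le> 2 ^ degree (p i) * cmod (poly q 0))"
    using circle_reflection by blast
  then obtain q where
    q: "\<And>i z. i \<in> I \<Longrightarrow> cmod z = 1 \<Longrightarrow> cmod (poly (q i) z) = cmod (poly (p i) z)"
       "\<And>i k. i \<in> I \<Longrightarrow> cmod (coeff (p i) k) \<le> 2 ^ degree (p i) * cmod (poly (q i) 0)"
    by metis
  obtain z where z: "cmod z = 1" "cmod (poly (\<Prod>i\<in>I. q i) 0) \<le> cmod (poly (\<Prod>i\<in>I. q i) z)"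
    using poly_maximum_modulus by blast
  have "(\<Prod>i\<in>I. cmod (coeff (p i) (k i))) \<le> (\<Prod>i\<in>I. 2 ^ w i * cmod (poly (q i) 0))"
  proof (intro prod_mono conjI)
    fix i assume i: "i \<in> I"
    have "cmod (coeff (p i) (k i)) \<le> 2 ^ degree (p i) * cmod (poly (q i) 0)"
      using q(2) i by blast
    also have "\<dots> \<le> 2 ^ w i * cmod (poly (q i) 0)"
      using deg[OF i] by (intro mult_right_mono power_increasing) auto
    finally show "cmod (coeff (p i) (k i)) \<le> 2 ^ w i * cmod (poly (q i) 0)" .
  qed simp
  also have "\<dots> = 2 ^ (\<Sum>i\<in>I. w i) * cmod (poly (\<Prod>i\<in>I. q i) 0)"
    by (simp add: prod.distrib power_sum poly_prod prod_norm)
  also have "\<dots> \<le> 2 ^ (\<Sum>i\<in>I. w i) * cmod (poly (\<Prod>i\<in>I. q i) z)"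
    by (intro mult_left_mono z) simp
  also have "cmod (poly (\<Prod>i\<in>I. q i) z) = (\<Prod>i\<in>I. cmod (poly (p i) z))"
    by (simp add: poly_prod prod_norm[symmetric] q(1) z(1) cong: prod.cong)
  finally show ?thesis using z(1) by blast
qed

text \<open>
  On the unit circle a Laurent sum differs from a polynomial only by a factor of modulus one.
\<close>

lemma simultaneous_large_values_laurent:
  fixes c :: "'i \<Rightarrow> int \<Rightarrow> complex"
  assumes "finite I" and k: "\<And>i. i \<in> I \<Longrightarrow> k i \<in> {\<alpha> i..\<alpha> i + int (w i)}"
  shows "\<exists>t. cmod t = 1 \<and>
           (\<Prod>i\<in>I. cmod (c i (k i))) \<le>
             2 ^ (\<Sum>i\<in>I. w i) * (\<Prod>i\<in>I. cmod (\<Sum>n\<in>{\<alpha> i..\<alpha> i + int (w i)}. c i n * t powi n))"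
proof -
  define p where "p = (\<lambda>i. \<Sum>m\<le>w i. monom (c i (\<alpha> i + int m)) m)"
  have "degree (p i) \<le> w i" for i
    unfolding p_def by (rule degree_sum_le) (auto intro: order_trans[OF degree_monom_le])
  then obtain t where t: "cmod t = 1"
    "(\<Prod>i\<in>I. cmod (coeff (p i) (nat (k i - \<alpha> i)))) \<le> 2 ^ (\<Sum>i\<in>I. w i) * (\<Prod>i\<in>I. cmod (poly (p i) t))"
    using simultaneous_large_values[OF assms(1), of p w "\<lambda>i. nat (k i - \<alpha> i)"] by blast
  have t0: "t \<noteq> 0" using t(1) by auto
  have coeff: "coeff (p i) (nat (k i - \<alpha> i)) = c i (k i)" if "i \<in> I" for i
    using k[OF that] by (auto simp: p_def coeff_sum nat_le_iff)
  have "cmod (poly (p i) t) = cmod (\<Sum>n\<in>{\<alpha> i..\<alpha> i + int (w i)}. c i n * t powi n)" for i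
  proof -
    have "(\<Sum>n\<in>{\<alpha> i..\<alpha> i + int (w i)}. c i n * t powi n) =
          (\<Sum>m\<le>w i. c i (\<alpha> i + int m) * t powi (\<alpha> i + int m))"
      by (rule sum.reindex_bij_witness[of _ "\<lambda>m. \<alpha> i + int m" "\<lambda>n. nat (n - \<alpha> i)"]) auto
    also have "\<dots> = t powi \<alpha> i * poly (p i) t"
      using t0 by (simp add: p_def poly_sum poly_monom power_int_add sum_distrib_left mult_ac)
    finally show ?thesis
      using t(1) by (simp add: norm_mult norm_power_int)
  qed
  with t coeff show ?thesis
    by (intro exI[of _ t]) (simp cong: prod.cong)
qed

section \<open>Large values on the torus\<close>

definition lattice_box :: "('d \<Rightarrow> int) \<Rightarrow> nat \<Rightarrow> (int ^ 'd) set" where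
  "lattice_box \<alpha> V = {n. \<forall>j. n $ j \<in> {\<alpha> j..\<alpha> j + int V}}"

lemma bij_betw_lattice_box:
  fixes \<alpha> :: "'d::finite \<Rightarrow> int"
  shows "bij_betw vec_nth (lattice_box \<alpha> V) (PiE UNIV (\<lambda>j. {\<alpha> j..\<alpha> j + int V}))"
  by (rule bij_betw_byWitness[where f' = vec_lambda]) (auto simp: lattice_box_def PiE_iff)

lemma finite_lattice_box [simp]:
  "finite (lattice_box (\<alpha> :: 'd::finite \<Rightarrow> int) V)"
  using bij_betw_finite[OF bij_betw_lattice_box[of \<alpha> V]] by (simp add: finite_PiE)

lemma card_lattice_box:
  "card (lattice_box (\<alpha> :: 'd::finite \<Rightarrow> int) V) = (V + 1) ^ CARD('d)"
  using bij_betw_same_card[OF bij_betw_lattice_box[of \<alpha> V]] by (simp add: card_PiE nat_add_distrib)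

text \<open>
  The variables are evaluated one at a time. The sum on the right is the coefficient, as a
  Laurent polynomial in the variables in \<open>S\<close>, of the monomial that \<open>m i\<close> prescribes in the
  variables outside \<open>S\<close>. Evaluating a further variable \<open>l\<close> turns this coefficient
  into one coefficient of a Laurent sum in the single variable \<open>x\<^sub>l\<close>, to which the
  one-variable bound applies. The coordinate \<open>z l\<close> may depend on the coordinates chosen
  before.
\<close>

lemma simultaneous_large_values_partial:
  fixes c :: "'i \<Rightarrow> int ^ 'd::finite \<Rightarrow> complex"
  assumes "finite I" and m: "\<And>i. i \<in> I \<Longrightarrow> m i \<in> lattice_box (\<alpha> i) (V i)" and "finite S"
  shows "\<exists>z. (\<forall>j. cmod (z j) = 1) \<and>
           (\<Prod>i\<in>I. cmod (c i (m i))) \<le> 2 ^ (card S * (\<Sum>i\<in>I. V i)) *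
             (\<Prod>i\<in>I. cmod (\<Sum>n | n \<in> lattice_box (\<alpha> i) (V i) \<and> (\<forall>j. j \<notin> S \<longrightarrow> n $ j = m i $ j).
                           c i n * (\<Prod>j\<in>S. z j powi (n $ j))))"
  using assms(3)
proof (induction S rule: finite_induct)
  case empty
  have "{n. n \<in> lattice_box (\<alpha> i) (V i) \<and> (\<forall>j. n $ j = m i $ j)} = {m i}" if "i \<in> I" for i
    using m[OF that] by (auto simp: vec_eq_iff)
  then show ?case
    by (intro exI[of _ "\<lambda>_. 1"]) (simp cong: prod.cong)
next
  case (insert l S)
  define A where "A = (\<lambda>S i. {n. n \<in> lattice_box (\<alpha> i) (V i) \<and> (\<forall>j. j \<notin> S \<longrightarrow> n $ j = m i $ j)})"
  have finA: "finite (A T i)" for T i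
    unfolding A_def by simp
  from insert.IH obtain z where z: "\<And>j. cmod (z j) = 1"
    "(\<Prod>i\<in>I. cmod (c i (m i))) \<le> 2 ^ (card S * (\<Sum>i\<in>I. V i)) *
       (\<Prod>i\<in>I. cmod (\<Sum>n\<in>A S i. c i n * (\<Prod>j\<in>S. z j powi (n $ j))))"
    by (auto simp: A_def)
  define C where "C = (\<lambda>i k. \<Sum>n | n \<in> A (insert l S) i \<and> n $ l = k. c i n * (\<Prod>j\<in>S. z j powi (n $ j)))"
  have "m i $ l \<in> {\<alpha> i l..\<alpha> i l + int (V i)}" if "i \<in> I" for i
    using m[OF that] by (auto simp: lattice_box_def)
  from simultaneous_large_values_laurent[where k = "\<lambda>i. m i $ l" and \<alpha> = "\<lambda>i. \<alpha> i l" and w = V and c = C,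
      OF assms(1) this]
  obtain t where t: "cmod t = 1"
    "(\<Prod>i\<in>I. cmod (C i (m i $ l))) \<le> 2 ^ (\<Sum>i\<in>I. V i) *
       (\<Prod>i\<in>I. cmod (\<Sum>k\<in>{\<alpha> i l..\<alpha> i l + int (V i)}. C i k * t powi k))"
    by auto
  define z' where "z' = z(l := t)"
  have S: "(\<Prod>j\<in>S. z' j powi (n $ j)) = (\<Prod>j\<in>S. z j powi (n $ j))" for n
    using insert.hyps by (intro prod.cong) (auto simp: z'_def)
  have C1: "C i (m i $ l) = (\<Sum>n\<in>A S i. c i n * (\<Prod>j\<in>S. z j powi (n $ j)))" for i
  proof -
    have "{n. n \<in> A (insert l S) i \<and> n $ l = m i $ l} = A S i"
      using insert.hyps by (auto simp: A_def)
    then show ?thesis by (simp add: C_def)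
  qed
  have C2: "(\<Sum>k\<in>{\<alpha> i l..\<alpha> i l + int (V i)}. C i k * t powi k) =
            (\<Sum>n\<in>A (insert l S) i. c i n * (\<Prod>j\<in>insert l S. z' j powi (n $ j)))" for i
  proof -
    have "(\<Sum>n\<in>A (insert l S) i. c i n * (\<Prod>j\<in>insert l S. z' j powi (n $ j))) =
          (\<Sum>n\<in>A (insert l S) i. c i n * (\<Prod>j\<in>S. z j powi (n $ j)) * t powi (n $ l))"
      using insert.hyps by (simp add: S) (simp add: z'_def mult_ac)
    also have "\<dots> = (\<Sum>k\<in>{\<alpha> i l..\<alpha> i l + int (V i)}.
        \<Sum>n | n \<in> A (insert l S) i \<and> n $ l = k. c i n * (\<Prod>j\<in>S. z j powi (n $ j)) * t powi (n $ l))"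
    proof (rule sum.group[symmetric])
      show "(\<lambda>n. n $ l) ` A (insert l S) i \<subseteq> {\<alpha> i l..\<alpha> i l + int (V i)}"
        by (auto simp: A_def lattice_box_def)
    qed (simp_all add: finA)
    also have "\<dots> = (\<Sum>k\<in>{\<alpha> i l..\<alpha> i l + int (V i)}. C i k * t powi k)"
      by (intro sum.cong) (auto simp: C_def sum_distrib_right)
    finally show ?thesis by simp
  qed
  have "(\<Prod>i\<in>I. cmod (c i (m i))) \<le> 2 ^ (card S * (\<Sum>i\<in>I. V i)) * (\<Prod>i\<in>I. cmod (C i (m i $ l)))"
    using z(2) by (simp add: C1)
  also have "\<dots> \<le> 2 ^ (card S * (\<Sum>i\<in>I. V i)) * (2 ^ (\<Sum>i\<in>I. V i) *
       (\<Prod>i\<in>I. cmod (\<Sum>k\<in>{\<alpha> i l..\<alpha> i l + int (V i)}. C i k * t powi k)))"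
    by (intro mult_left_mono t(2)) simp
  also have "\<dots> = 2 ^ (card (insert l S) * (\<Sum>i\<in>I. V i)) *
       (\<Prod>i\<in>I. cmod (\<Sum>n\<in>A (insert l S) i. c i n * (\<Prod>j\<in>insert l S. z' j powi (n $ j))))"
    using insert.hyps by (simp only: C2) (simp add: power_add mult_ac)
  finally have "(\<Prod>i\<in>I. cmod (c i (m i))) \<le> \<dots>" .
  moreover have "\<forall>j. cmod (z' j) = 1"
    using z(1) t(1) by (simp add: z'_def)
  ultimately show ?case unfolding A_def by blast
qed

lemma simultaneous_large_values_lattice:
  fixes c :: "'i \<Rightarrow> int ^ 'd::finite \<Rightarrow> complex"
  assumes "finite I" and "\<And>i. i \<in> I \<Longrightarrow> m i \<in> lattice_box (\<alpha> i) (V i)"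
  shows "\<exists>z. (\<forall>j. cmod (z j) = 1) \<and>
           (\<Prod>i\<in>I. cmod (c i (m i))) \<le> 2 ^ (CARD('d) * (\<Sum>i\<in>I. V i)) *
             (\<Prod>i\<in>I. cmod (\<Sum>n\<in>lattice_box (\<alpha> i) (V i). c i n * (\<Prod>j\<in>UNIV. z j powi (n $ j))))"
  using simultaneous_large_values_partial[OF assms finite_class.finite_UNIV, where c = c] by simp

section \<open>Values, lengths and heights of Laurent polynomials\<close>

lemma poly_mapping_sum_single:
  fixes p :: "'a \<Rightarrow>\<^sub>0 'b::comm_monoid_add"
  shows "p = (\<Sum>k\<in>Poly_Mapping.keys p. Poly_Mapping.single k (Poly_Mapping.lookup p k))"
proof (rule poly_mapping_eqI)
  fix k
  show "Poly_Mapping.lookup p k =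
    Poly_Mapping.lookup (\<Sum>k\<in>Poly_Mapping.keys p. Poly_Mapping.single k (Poly_Mapping.lookup p k)) k"
    by (simp add: lookup_sum lookup_single when_def sum.delta' in_keys_iff)
qed

lemma times_poly_mapping_sum_single:
  fixes p q :: "'a::monoid_add \<Rightarrow>\<^sub>0 'b::semiring_0"
  shows "p * q = (\<Sum>k\<in>Poly_Mapping.keys p. \<Sum>l\<in>Poly_Mapping.keys q.
     Poly_Mapping.single (k + l) (Poly_Mapping.lookup p k * Poly_Mapping.lookup q l))"
  by (subst poly_mapping_sum_single[of p], subst poly_mapping_sum_single[of q])
     (simp add: sum_product mult_single)

definition monomial_value :: "('d::finite \<Rightarrow> complex) \<Rightarrow> int ^ 'd \<Rightarrow> complex" where
  "monomial_value z n = (\<Prod>j\<in>UNIV. z j powi (n $ j))"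

lemma monomial_value_add:
  assumes "\<And>j. z j \<noteq> 0"
  shows "monomial_value z (m + n) = monomial_value z m * monomial_value z n"
  using assms by (simp add: monomial_value_def power_int_add prod.distrib)

definition laurent_eval :: "('d::finite \<Rightarrow> complex) \<Rightarrow> 'd laurent \<Rightarrow> complex" where
  "laurent_eval z p = (\<Sum>n\<in>Poly_Mapping.keys p. Poly_Mapping.lookup p n * monomial_value z n)"

lemma laurent_eval_superset:
  assumes "finite A" "Poly_Mapping.keys p \<subseteq> A"
  shows "laurent_eval z p = (\<Sum>n\<in>A. Poly_Mapping.lookup p n * monomial_value z n)"
  unfolding laurent_eval_def using assms
  by (intro sum.mono_neutral_left) (auto simp: in_keys_iff)

lemma laurent_eval_add: "laurent_eval z (p + q) = laurent_eval z p + laurent_eval z q"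
proof -
  let ?A = "Poly_Mapping.keys p \<union> Poly_Mapping.keys q"
  have "laurent_eval z r = (\<Sum>n\<in>?A. Poly_Mapping.lookup r n * monomial_value z n)"
    if "r \<in> {p, q, p + q}" for r
    using that Poly_Mapping.keys_add[of p q] by (intro laurent_eval_superset) auto
  then show ?thesis
    by (simp add: lookup_add sum.distrib ring_distribs)
qed

lemma laurent_eval_zero [simp]: "laurent_eval z 0 = 0"
  by (simp add: laurent_eval_def)

lemma laurent_eval_sum: "laurent_eval z (\<Sum>i\<in>I. p i) = (\<Sum>i\<in>I. laurent_eval z (p i))"
  by (induction I rule: infinite_finite_induct) (simp_all add: laurent_eval_add)

lemma laurent_eval_single: "laurent_eval z (Poly_Mapping.single n a) = a * monomial_value z n"
  by (simp add: laurent_eval_def)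

lemma laurent_eval_mult:
  assumes "\<And>j. z j \<noteq> 0"
  shows "laurent_eval z (p * q) = laurent_eval z p * laurent_eval z q"
proof -
  have "laurent_eval z (p * q) = (\<Sum>k\<in>Poly_Mapping.keys p. \<Sum>l\<in>Poly_Mapping.keys q.
      (Poly_Mapping.lookup p k * monomial_value z k) * (Poly_Mapping.lookup q l * monomial_value z l))"
    by (subst times_poly_mapping_sum_single)
       (simp add: laurent_eval_sum laurent_eval_single monomial_value_add assms mult_ac)
  then show ?thesis
    by (simp add: laurent_eval_def sum_product)
qed

lemma laurent_eval_one [simp]: "laurent_eval z 1 = 1"
  by (simp add: laurent_eval_def monomial_value_def)

lemma laurent_eval_prod:
  assumes "\<And>j. z j \<noteq> 0"
  shows "laurent_eval z (\<Prod>i\<in>I. p i) = (\<Prod>i\<in>I. laurent_eval z (p i))"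
  by (induction I rule: infinite_finite_induct) (simp_all add: laurent_eval_mult assms)

definition real_vec :: "int ^ 'd \<Rightarrow> real ^ 'd" where
  "real_vec n = (\<chi> i. real_of_int (n $ i))"

lemma real_vec_add: "real_vec (m + n) = real_vec m + real_vec n"
  by (simp add: real_vec_def vec_eq_iff)

text \<open>
  The sum of the moduli of the coefficients of \<open>p (exp u\<^sub>1 x\<^sub>1, \<dots>, exp u\<^sub>d x\<^sub>d)\<close>. It is
  submultiplicative and bounds the modulus of \<open>p\<close> on the torus of radii \<open>exp u\<^sub>j\<close>, so it links
  values to coefficients.
\<close>

definition weighted_length :: "real ^ 'd::finite \<Rightarrow> 'd laurent \<Rightarrow> real" where
  "weighted_length u p =
     (\<Sum>n\<in>Poly_Mapping.keys p. cmod (Poly_Mapping.lookup p n) * exp (u \<bullet> real_vec n))"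

lemma weighted_length_superset:
  assumes "finite A" "Poly_Mapping.keys p \<subseteq> A"
  shows "weighted_length u p = (\<Sum>n\<in>A. cmod (Poly_Mapping.lookup p n) * exp (u \<bullet> real_vec n))"
  unfolding weighted_length_def using assms
  by (intro sum.mono_neutral_left) (auto simp: in_keys_iff)

lemma weighted_length_nonneg: "weighted_length u p \<ge> 0"
  by (auto simp: weighted_length_def intro!: sum_nonneg)

lemma weighted_length_add: "weighted_length u (p + q) \<le> weighted_length u p + weighted_length u q"
proof -
  let ?A = "Poly_Mapping.keys p \<union> Poly_Mapping.keys q"
  have *: "weighted_length u r = (\<Sum>n\<in>?A. cmod (Poly_Mapping.lookup r n) * exp (u \<bullet> real_vec n))"
    if "r \<in> {p, q, p + q}" for r
    using that Poly_Mapping.keys_add[of p q] by (intro weighted_length_superset) auto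
  have "weighted_length u (p + q) = (\<Sum>n\<in>?A. cmod (Poly_Mapping.lookup (p + q) n) * exp (u \<bullet> real_vec n))"
    by (rule *) simp
  also have "\<dots> \<le> (\<Sum>n\<in>?A. cmod (Poly_Mapping.lookup p n) * exp (u \<bullet> real_vec n)
                        + cmod (Poly_Mapping.lookup q n) * exp (u \<bullet> real_vec n))"
    unfolding lookup_add distrib_right[symmetric]
    by (intro sum_mono mult_right_mono norm_triangle_ineq) auto
  also have "\<dots> = weighted_length u p + weighted_length u q"
    by (simp add: sum.distrib *)
  finally show ?thesis .
qed

lemma weighted_length_sum: "weighted_length u (\<Sum>i\<in>I. p i) \<le> (\<Sum>i\<in>I. weighted_length u (p i))"
proof (induction I rule: infinite_finite_induct)
  case (insert i I)
  then show ?case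
    using weighted_length_add[of u "p i" "\<Sum>i\<in>I. p i"] by simp
qed (simp_all add: weighted_length_def)

lemma weighted_length_mult:
  "weighted_length u (p * q) \<le> weighted_length u p * weighted_length u q"
proof -
  have "weighted_length u (p * q) \<le> (\<Sum>k\<in>Poly_Mapping.keys p. \<Sum>l\<in>Poly_Mapping.keys q.
      weighted_length u (Poly_Mapping.single (k + l) (Poly_Mapping.lookup p k * Poly_Mapping.lookup q l)))"
    by (subst times_poly_mapping_sum_single)
       (intro order_trans[OF weighted_length_sum] sum_mono order_refl)
  also have "\<dots> = (\<Sum>k\<in>Poly_Mapping.keys p. \<Sum>l\<in>Poly_Mapping.keys q.
      (cmod (Poly_Mapping.lookup p k) * exp (u \<bullet> real_vec k)) *
      (cmod (Poly_Mapping.lookup q l) * exp (u \<bullet> real_vec l)))"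
    by (intro sum.cong refl)
       (auto simp: weighted_length_def norm_mult real_vec_add inner_add_right exp_add in_keys_iff)
  finally show ?thesis
    by (simp add: weighted_length_def sum_product)
qed

lemma weighted_length_prod:
  "weighted_length u (\<Prod>i\<in>I. p i) \<le> (\<Prod>i\<in>I. weighted_length u (p i))"
proof (induction I rule: infinite_finite_induct)
  case (insert i I)
  have "weighted_length u (p i * (\<Prod>i\<in>I. p i)) \<le> weighted_length u (p i) * weighted_length u (\<Prod>i\<in>I. p i)"
    by (rule weighted_length_mult)
  also have "\<dots> \<le> weighted_length u (p i) * (\<Prod>i\<in>I. weighted_length u (p i))"
    by (intro mult_left_mono insert weighted_length_nonneg)
  finally show ?case using insert by simp
qed (simp_all add: weighted_length_def real_vec_def zero_vec_def[symmetric])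

lemma norm_laurent_eval_le:
  assumes "\<And>j. cmod (z j) = exp (u $ j)"
  shows "cmod (laurent_eval z p) \<le> weighted_length u p"
proof -
  have "cmod (monomial_value z n) = exp (u \<bullet> real_vec n)" for n
  proof -
    have "cmod (monomial_value z n) = (\<Prod>j\<in>UNIV. exp (real_of_int (n $ j) * u $ j))"
      unfolding monomial_value_def prod_norm[symmetric]
      by (simp only: norm_power_int assms exp_power_int of_int_eq_id id_apply)
    then show ?thesis
      by (simp add: inner_vec_def real_vec_def exp_sum mult.commute)
  qed
  then show ?thesis
    unfolding laurent_eval_def weighted_length_def
    by (intro order_trans[OF norm_sum]) (simp add: norm_mult)
qed

definition log_height :: "real ^ 'd::finite \<Rightarrow> 'd laurent \<Rightarrow> real" where
  "log_height u p =
     Max ((\<lambda>n. ln (cmod (Poly_Mapping.lookup p n)) + u \<bullet> real_vec n) ` Poly_Mapping.keys p)"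

lemma log_height_ge:
  "n \<in> Poly_Mapping.keys p \<Longrightarrow> ln (cmod (Poly_Mapping.lookup p n)) + u \<bullet> real_vec n \<le> log_height u p"
  unfolding log_height_def by (intro Max_ge) auto

lemma log_height_attained:
  assumes "p \<noteq> 0"
  obtains n where "n \<in> Poly_Mapping.keys p"
    "log_height u p = ln (cmod (Poly_Mapping.lookup p n)) + u \<bullet> real_vec n"
proof -
  have "log_height u p \<in> (\<lambda>n. ln (cmod (Poly_Mapping.lookup p n)) + u \<bullet> real_vec n) ` Poly_Mapping.keys p"
    unfolding log_height_def using assms by (intro Max_in) auto
  then show ?thesis using that by auto
qed

lemma exp_log_coeff:
  assumes "n \<in> Poly_Mapping.keys p"
  shows "exp (ln (cmod (Poly_Mapping.lookup p n)) + u \<bullet> real_vec n) =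
         cmod (Poly_Mapping.lookup p n) * exp (u \<bullet> real_vec n)"
  using assms by (simp add: exp_add in_keys_iff)

lemma exp_log_height_le_length:
  assumes "p \<noteq> 0"
  shows "exp (log_height u p) \<le> weighted_length u p"
proof -
  obtain n where n: "n \<in> Poly_Mapping.keys p"
    "log_height u p = ln (cmod (Poly_Mapping.lookup p n)) + u \<bullet> real_vec n"
    using log_height_attained[OF assms] .
  show ?thesis
    unfolding n(2) exp_log_coeff[OF n(1)] weighted_length_def
    by (rule member_le_sum[OF n(1)]) auto
qed

lemma length_le_card_exp_log_height:
  "weighted_length u p \<le> real (card (Poly_Mapping.keys p)) * exp (log_height u p)"
proof -
  have "weighted_length u p \<le> (\<Sum>n\<in>Poly_Mapping.keys p. exp (log_height u p))"
    unfolding weighted_length_def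
    by (intro sum_mono) (simp flip: exp_log_coeff add: log_height_ge)
  then show ?thesis by simp
qed

section \<open>Gelfond's inequality\<close>

text \<open>
  The polynomial is a Laurent polynomial in the variables \<open>x\<^sub>j\<^sup>N\<close>, of width at most \<open>V\<close> in each of them.
  The box may lie anywhere, so multiplication by a monomial in the \<open>x\<^sub>j\<^sup>N\<close> changes nothing.
\<close>

definition spread :: "nat \<Rightarrow> nat \<Rightarrow> 'd::finite laurent \<Rightarrow> bool" where
  "spread N V p \<longleftrightarrow> (\<exists>\<alpha>. Poly_Mapping.keys p \<subseteq> (\<lambda>m. int N *s m) ` lattice_box \<alpha> V)"

lemma card_keys_spread:
  fixes p :: "'d::finite laurent"
  assumes "spread N V p"
  shows "card (Poly_Mapping.keys p) \<le> (V + 1) ^ CARD('d)"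
proof -
  obtain \<alpha> where "Poly_Mapping.keys p \<subseteq> (\<lambda>m. int N *s m) ` lattice_box \<alpha> V"
    using assms by (auto simp: spread_def)
  then have "card (Poly_Mapping.keys p) \<le> card (lattice_box \<alpha> V)"
    by (meson card_image_le card_mono finite_imageI finite_lattice_box order_trans)
  then show ?thesis by (simp only: card_lattice_box)
qed

lemma spread_one: "spread N 0 1"
  by (auto simp: spread_def lattice_box_def vec_eq_iff intro!: exI[of _ "\<lambda>_. 0"] image_eqI[of _ _ 0])

lemma spread_mult:
  assumes "spread N V p" "spread N W q"
  shows "spread N (V + W) (p * q)"
proof -
  obtain \<alpha> \<beta> where ab: "Poly_Mapping.keys p \<subseteq> (\<lambda>m. int N *s m) ` lattice_box \<alpha> V"
     "Poly_Mapping.keys q \<subseteq> (\<lambda>m. int N *s m) ` lattice_box \<beta> W"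
    using assms by (auto simp: spread_def)
  have "Poly_Mapping.keys (p * q) \<subseteq> (\<lambda>m. int N *s m) ` lattice_box (\<lambda>j. \<alpha> j + \<beta> j) (V + W)"
  proof
    fix n assume "n \<in> Poly_Mapping.keys (p * q)"
    then obtain a b where n: "n = a + b" "a \<in> Poly_Mapping.keys p" "b \<in> Poly_Mapping.keys q"
      using Poly_Mapping.keys_mult[of p q] by auto
    then obtain a' b' where ab': "a = int N *s a'" "a' \<in> lattice_box \<alpha> V"
      "b = int N *s b'" "b' \<in> lattice_box \<beta> W"
      using ab by blast
    have "a' + b' \<in> lattice_box (\<lambda>j. \<alpha> j + \<beta> j) (V + W)"
      using ab'(2,4) by (simp add: lattice_box_def) (smt (verit))
    then show "n \<in> (\<lambda>m. int N *s m) ` lattice_box (\<lambda>j. \<alpha> j + \<beta> j) (V + W)"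
      by (intro image_eqI[of _ _ "a' + b'"]) (simp_all add: n(1) ab' vector_add_ldistrib)
  qed
  then show ?thesis unfolding spread_def by blast
qed

lemma spread_prod:
  assumes "\<And>i. i \<in> I \<Longrightarrow> spread N (V i) (p i)"
  shows "spread N (\<Sum>i\<in>I. V i) (\<Prod>i\<in>I. p i)"
  using assms
  by (induction I rule: infinite_finite_induct) (simp_all add: spread_one spread_mult)

lemma unit_root_exists:
  fixes z :: complex
  assumes "cmod z = 1" "N > 0"
  shows "\<exists>y. cmod y = 1 \<and> y ^ N = z"
proof -
  have z: "z = cis (Arg z)"
    using assms(1) by (metis cis_Arg norm_zero sgn_div_norm zero_neq_one div_by_1 scaleR_one inverse_1)
  have "cis (Arg z / real N) ^ N = z"
    unfolding Complex.DeMoivre using assms(2) z by simp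
  then show ?thesis by (intro exI[of _ "cis (Arg z / real N)"]) simp
qed

lemma card_power_le_exp: "real ((V + 1) ^ d) \<le> exp (real d * real V)"
proof -
  have "real ((V + 1) ^ d) \<le> exp (real V) ^ d"
    using exp_ge_add_one_self[of "real V"] by (simp add: power_mono add.commute)
  then show ?thesis by (simp add: exp_of_nat_mult)
qed

text \<open>
  The torus bound is applied to the \<open>p i\<close> as Laurent polynomials in \<open>x\<^sub>j\<^sup>N\<close>, with the
  coefficients weighted by \<open>exp (u \<bullet> n)\<close>. An \<open>N\<close>th root of the resulting point, scaled to the radii
  \<open>exp (u $ j)\<close>, is a point at which all \<open>p i\<close> are simultaneously large.
\<close>

lemma gelfond_large_value:
  fixes p :: "'i \<Rightarrow> 'd::finite laurent"
  assumes "finite I" "N > 0"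
    and p: "\<And>i. i \<in> I \<Longrightarrow> p i \<noteq> 0" "\<And>i. i \<in> I \<Longrightarrow> spread N (V i) (p i)"
  obtains z where "\<And>j. cmod (z j) = exp (u $ j)"
    "exp (\<Sum>i\<in>I. log_height u (p i)) \<le>
       2 ^ (CARD('d) * (\<Sum>i\<in>I. V i)) * cmod (laurent_eval z (\<Prod>i\<in>I. p i))"
proof -
  have "\<forall>i\<in>I. \<exists>n. n \<in> Poly_Mapping.keys (p i) \<and>
      log_height u (p i) = ln (cmod (Poly_Mapping.lookup (p i) n)) + u \<bullet> real_vec n"
    using log_height_attained p(1) by metis
  then obtain n where n: "\<And>i. i \<in> I \<Longrightarrow> n i \<in> Poly_Mapping.keys (p i)"
      "\<And>i. i \<in> I \<Longrightarrow> log_height u (p i) = ln (cmod (Poly_Mapping.lookup (p i) (n i))) + u \<bullet> real_vec (n i)"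
    by metis
  have "\<forall>i\<in>I. \<exists>\<alpha>. Poly_Mapping.keys (p i) \<subseteq> (\<lambda>m. int N *s m) ` lattice_box \<alpha> (V i)"
    using p(2) by (auto simp: spread_def)
  then obtain \<alpha> where \<alpha>:
    "\<And>i. i \<in> I \<Longrightarrow> Poly_Mapping.keys (p i) \<subseteq> (\<lambda>m. int N *s m) ` lattice_box (\<alpha> i) (V i)"
    by metis
  then have "\<forall>i\<in>I. \<exists>m. m \<in> lattice_box (\<alpha> i) (V i) \<and> n i = int N *s m"
    using n(1) by blast
  then obtain m where m: "\<And>i. i \<in> I \<Longrightarrow> m i \<in> lattice_box (\<alpha> i) (V i)"
      "\<And>i. i \<in> I \<Longrightarrow> n i = int N *s m i"
    by metis
  define c where "c = (\<lambda>i k. Poly_Mapping.lookup (p i) (int N *s k) * of_real (exp (u \<bullet> real_vec (int N *s k))))"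
  obtain z where z: "\<And>j. cmod (z j) = 1"
     "(\<Prod>i\<in>I. cmod (c i (m i))) \<le> 2 ^ (CARD('d) * (\<Sum>i\<in>I. V i)) *
       (\<Prod>i\<in>I. cmod (\<Sum>k\<in>lattice_box (\<alpha> i) (V i). c i k * (\<Prod>j\<in>UNIV. z j powi (k $ j))))"
    using simultaneous_large_values_lattice[where m = m and \<alpha> = \<alpha> and V = V and c = c, OF assms(1) m(1)]
    by blast
  have "\<forall>j. \<exists>y. cmod y = 1 \<and> y ^ N = z j"
    using unit_root_exists z(1) assms(2) by blast
  then obtain y where y: "\<And>j. cmod (y j) = 1" "\<And>j. y j ^ N = z j"
    by metis
  \<comment> \<open>At this point the monomial with exponent \<open>N k\<close> takes the value \<open>exp (u \<bullet> N k)\<close> times \<open>z\<^sup>k\<close>.\<close>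
  define x where "x = (\<lambda>j. of_real (exp (u $ j)) * y j)"
  have y0: "y j \<noteq> 0" for j using y(1)[of j] by auto
  have x0: "x j \<noteq> 0" for j using y0 by (simp add: x_def)
  have x1: "cmod (x j) = exp (u $ j)" for j
    by (simp add: x_def norm_mult y)
  have mon: "monomial_value x (int N *s k) =
      of_real (exp (u \<bullet> real_vec (int N *s k))) * (\<Prod>j\<in>UNIV. z j powi (k $ j))" for k
  proof -
    have "x j powi (int N * (k $ j)) = of_real (exp (u $ j * (real N * real_of_int (k $ j)))) * z j powi (k $ j)" for j
    proof -
      have "y j powi (int N * (k $ j)) = z j powi (k $ j)"
        using y(2)[of j] by (simp add: power_int_mult)
      moreover have "exp (u $ j) powi (int N * (k $ j)) = exp (u $ j * (real N * real_of_int (k $ j)))"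
        by (simp add: exp_power_int mult_ac)
      ultimately show ?thesis
        unfolding x_def power_int_mult_distrib by (simp flip: of_real_power_int)
    qed
    then show ?thesis
      by (simp add: monomial_value_def inner_vec_def real_vec_def exp_sum prod.distrib)
  qed
  have ev: "laurent_eval x (p i) = (\<Sum>k\<in>lattice_box (\<alpha> i) (V i). c i k * (\<Prod>j\<in>UNIV. z j powi (k $ j)))"
    if "i \<in> I" for i
  proof -
    have "inj_on (\<lambda>m. int N *s m) (lattice_box (\<alpha> i) (V i))"
      using assms(2) by (auto simp: inj_on_def vec_eq_iff)
    then show ?thesis
      by (subst laurent_eval_superset[OF _ \<alpha>[OF that]])
         (simp_all add: sum.reindex mon c_def mult_ac)
  qed
  have "exp (\<Sum>i\<in>I. log_height u (p i)) = (\<Prod>i\<in>I. cmod (c i (m i)))"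
    using assms(1) n m by (auto simp: exp_sum exp_log_coeff c_def norm_mult intro!: prod.cong)
  also have "\<dots> \<le> 2 ^ (CARD('d) * (\<Sum>i\<in>I. V i)) * (\<Prod>i\<in>I. cmod (laurent_eval x (p i)))"
    using z(2) by (simp add: ev cong: prod.cong)
  also have "(\<Prod>i\<in>I. cmod (laurent_eval x (p i))) = cmod (laurent_eval x (\<Prod>i\<in>I. p i))"
    by (simp add: laurent_eval_prod x0 prod_norm)
  finally show ?thesis using that x1 by blast
qed

text \<open>
  The product is nonzero because it does not vanish at the point found above.
\<close>

lemma prod_laurent_nonzero:
  fixes p :: "'i \<Rightarrow> 'd::finite laurent"
  assumes "finite I" "N > 0"
    and p: "\<And>i. i \<in> I \<Longrightarrow> p i \<noteq> 0" "\<And>i. i \<in> I \<Longrightarrow> spread N (V i) (p i)"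
  shows "(\<Prod>i\<in>I. p i) \<noteq> 0"
proof
  assume "(\<Prod>i\<in>I. p i) = 0"
  obtain z where
    "exp (\<Sum>i\<in>I. log_height 0 (p i)) \<le>
       2 ^ (CARD('d) * (\<Sum>i\<in>I. V i)) * cmod (laurent_eval z (\<Prod>i\<in>I. p i))"
    using gelfond_large_value[where u = 0 and p = p, OF assms(1,2) p] by blast
  with \<open>(\<Prod>i\<in>I. p i) = 0\<close> show False by simp
qed

text \<open>
  One direction compares the values at a common large point with the length of the product; the
  other uses that the length is submultiplicative. Lengths and heights are compared through the number
  of exponents, which is polynomial in the width and therefore at most exponential. No term
  depends on the number of factors.
\<close>

theorem gelfond_inequality:
  fixes p :: "'i \<Rightarrow> 'd::finite laurent"
  assumes "finite I" "N > 0"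
    and p: "\<And>i. i \<in> I \<Longrightarrow> p i \<noteq> 0" "\<And>i. i \<in> I \<Longrightarrow> spread N (V i) (p i)"
  shows "\<bar>(\<Sum>i\<in>I. log_height u (p i)) - log_height u (\<Prod>i\<in>I. p i)\<bar>
           \<le> 2 * real CARD('d) * real (\<Sum>i\<in>I. V i)"
proof -
  define P where "P = (\<Prod>i\<in>I. p i)"
  define D where "D = real CARD('d) * real (\<Sum>i\<in>I. V i)"
  have D0: "D \<ge> 0" unfolding D_def by (intro mult_nonneg_nonneg of_nat_0_le_iff)
  have P0: "P \<noteq> 0"
    unfolding P_def by (rule prod_laurent_nonzero[where p = p, OF assms(1,2) p])
  have len: "weighted_length u q \<le> exp (real CARD('d) * real W) * exp (log_height u q)"
    if "spread N W q" for W and q :: "'d laurent"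
  proof -
    have "real (card (Poly_Mapping.keys q)) \<le> exp (real CARD('d) * real W)"
      using of_nat_mono[OF card_keys_spread[OF that]] card_power_le_exp[of W "CARD('d)"] by (rule order_trans)
    then show ?thesis
      by (intro order_trans[OF length_le_card_exp_log_height] mult_right_mono) auto
  qed
  obtain z where z: "\<And>j. cmod (z j) = exp (u $ j)"
    "exp (\<Sum>i\<in>I. log_height u (p i)) \<le>
       2 ^ (CARD('d) * (\<Sum>i\<in>I. V i)) * cmod (laurent_eval z P)"
    using gelfond_large_value[where u = u and p = p, OF assms(1,2) p] unfolding P_def by blast
  \<comment> \<open>With base \<open>exp 1\<close> in place of \<open>2\<close> all error terms are powers of \<open>exp D\<close>.\<close>
  have two: "(2::real) ^ (CARD('d) * (\<Sum>i\<in>I. V i)) \<le> exp D"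
  proof -
    have "(2::real) ^ (CARD('d) * (\<Sum>i\<in>I. V i)) \<le> exp 1 ^ (CARD('d) * (\<Sum>i\<in>I. V i))"
      using exp_ge_add_one_self[of 1] by (intro power_mono) auto
    also have "\<dots> = exp D"
      unfolding D_def of_nat_mult[symmetric] exp_of_nat_mult[symmetric] by simp
    finally show ?thesis .
  qed
  have "cmod (laurent_eval z P) \<le> exp D * exp (log_height u P)"
  proof -
    have "spread N (\<Sum>i\<in>I. V i) P"
      unfolding P_def by (rule spread_prod[where p = p, OF p(2)])
    from order_trans[OF norm_laurent_eval_le[OF z(1)] len[OF this]] show ?thesis
      by (simp only: D_def)
  qed
  then have "exp (\<Sum>i\<in>I. log_height u (p i)) \<le> exp D * (exp D * exp (log_height u P))"
    using two by (intro order_trans[OF z(2)] mult_mono) auto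
  also have "\<dots> = exp (2 * D + log_height u P)"
    by (simp flip: exp_add)
  finally have lower: "(\<Sum>i\<in>I. log_height u (p i)) \<le> 2 * D + log_height u P" by simp
  have "exp (log_height u P) \<le> weighted_length u P"
    by (rule exp_log_height_le_length[OF P0])
  also have "\<dots> \<le> (\<Prod>i\<in>I. weighted_length u (p i))"
    unfolding P_def by (rule weighted_length_prod)
  also have "\<dots> \<le> (\<Prod>i\<in>I. exp (real CARD('d) * real (V i)) * exp (log_height u (p i)))"
    by (intro prod_mono conjI weighted_length_nonneg len p(2))
  also have "\<dots> = exp (D + (\<Sum>i\<in>I. log_height u (p i)))"
    by (simp only: D_def exp_add prod.distrib exp_sum[OF assms(1)] sum_distrib_left of_nat_sum)
  finally have "log_height u P \<le> D + (\<Sum>i\<in>I. log_height u (p i))" by simp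
  with lower D0 have "\<bar>(\<Sum>i\<in>I. log_height u (p i)) - log_height u P\<bar> \<le> 2 * D" by linarith
  then show ?thesis
    by (simp only: P_def D_def mult.assoc)
qed

section \<open>Decimations\<close>

lemma lookup_rescale_vars:
  "Poly_Mapping.lookup (rescale_vars c f) n = Poly_Mapping.lookup f n * monomial_value (vec_nth c) n"
  by (simp add: rescale_vars_def lookup_mapp when_def monomial_value_def in_keys_iff)

lemma rescale_vars_add: "rescale_vars c (f + g) = rescale_vars c f + rescale_vars c g"
  by (rule poly_mapping_eqI) (simp add: lookup_rescale_vars lookup_add ring_distribs)

lemma rescale_vars_zero [simp]: "rescale_vars c 0 = 0"
  by (rule poly_mapping_eqI) (simp add: lookup_rescale_vars)

lemma rescale_vars_sum: "rescale_vars c (\<Sum>i\<in>I. f i) = (\<Sum>i\<in>I. rescale_vars c (f i))"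
  by (induction I rule: infinite_finite_induct) (simp_all add: rescale_vars_add)

lemma rescale_vars_single:
  "rescale_vars c (Poly_Mapping.single n a) = Poly_Mapping.single n (a * monomial_value (vec_nth c) n)"
  by (rule poly_mapping_eqI) (simp add: lookup_rescale_vars lookup_single when_def)

lemma keys_rescale_vars:
  assumes "\<And>j. c $ j \<noteq> 0"
  shows "Poly_Mapping.keys (rescale_vars c f) = Poly_Mapping.keys f"
  using assms by (auto simp: in_keys_iff lookup_rescale_vars monomial_value_def)

lemma rescale_vars_mult:
  assumes "\<And>j. c $ j \<noteq> 0"
  shows "rescale_vars c (f * g) = rescale_vars c f * rescale_vars c g"
proof -
  have "rescale_vars c f * rescale_vars c g =
      (\<Sum>k\<in>Poly_Mapping.keys f. \<Sum>l\<in>Poly_Mapping.keys g. Poly_Mapping.single (k + l)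
         (Poly_Mapping.lookup f k * Poly_Mapping.lookup g l * monomial_value (vec_nth c) (k + l)))"
    by (subst times_poly_mapping_sum_single)
       (simp add: keys_rescale_vars assms lookup_rescale_vars monomial_value_add mult_ac)
  also have "\<dots> = rescale_vars c (f * g)"
    by (subst times_poly_mapping_sum_single) (simp add: rescale_vars_sum rescale_vars_single)
  finally show ?thesis by simp
qed

lemma rescale_vars_one: "rescale_vars c 1 = 1"
  by (rule poly_mapping_eqI) (simp add: lookup_rescale_vars lookup_one when_def monomial_value_def)

lemma rescale_vars_prod:
  assumes "\<And>j. c $ j \<noteq> 0"
  shows "rescale_vars c (\<Prod>i\<in>I. f i) = (\<Prod>i\<in>I. rescale_vars c (f i))"
  by (induction I rule: infinite_finite_induct) (simp_all add: rescale_vars_one rescale_vars_mult assms)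

lemma rescale_vars_rescale_vars:
  "rescale_vars c (rescale_vars c' f) = rescale_vars (\<chi> j. c $ j * c' $ j) f"
  by (rule poly_mapping_eqI)
     (simp add: lookup_rescale_vars monomial_value_def power_int_mult_distrib prod.distrib mult_ac)

lemma log_height_rescale_vars:
  assumes "\<And>j. cmod (c $ j) = 1"
  shows "log_height u (rescale_vars c f) = log_height u f"
proof -
  have "cmod (monomial_value (vec_nth c) n) = 1" for n
    by (simp add: monomial_value_def prod_norm[symmetric] norm_power_int assms)
  moreover have "c $ j \<noteq> 0" for j
    using assms[of j] by auto
  ultimately show ?thesis
    by (simp add: log_height_def keys_rescale_vars lookup_rescale_vars norm_mult)
qed

definition torsion_point :: "nat \<Rightarrow> nat ^ 'd \<Rightarrow> complex ^ 'd" where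
  "torsion_point N k = (\<chi> i. exp (2 * of_real pi * \<i> * of_nat (k $ i) / of_nat N))"

lemma norm_torsion_point [simp]: "cmod (torsion_point N k $ j) = 1"
  by (simp add: torsion_point_def)

lemma torsion_point_nonzero [simp]: "torsion_point N k $ j \<noteq> 0"
  by (simp add: torsion_point_def)

definition index_cube :: "nat \<Rightarrow> (nat ^ 'd) set" where
  "index_cube N = {k. \<forall>i. k $ i < N}"

lemma decimation_eq: "decimation N f = (\<Prod>k\<in>index_cube N. rescale_vars (torsion_point N k) f)"
  by (simp add: decimation_def index_cube_def torsion_point_def)

lemma bij_betw_index_cube: "bij_betw vec_nth (index_cube N :: (nat ^ 'd::finite) set) (PiE UNIV (\<lambda>_. {..<N}))"
  by (rule bij_betw_byWitness[where f' = vec_lambda]) (auto simp: index_cube_def PiE_iff)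

lemma finite_index_cube [simp]: "finite (index_cube N :: (nat ^ 'd::finite) set)"
  using bij_betw_finite[OF bij_betw_index_cube[where N = N and 'd = 'd]] by (simp add: finite_PiE)

lemma card_index_cube: "card (index_cube N :: (nat ^ 'd::finite) set) = N ^ CARD('d)"
  using bij_betw_same_card[OF bij_betw_index_cube[where N = N and 'd = 'd]] by (simp add: card_PiE)

lemma decimation_mult: "decimation N (f * g) = decimation N f * decimation N g"
  by (simp add: decimation_eq rescale_vars_mult prod.distrib)

lemma decimation_1:
  fixes f :: "'d::finite laurent"
  shows "decimation 1 f = f"
proof -
  have "index_cube 1 = {0 :: nat ^ 'd}"
    by (auto simp: index_cube_def vec_eq_iff)
  moreover have "rescale_vars (torsion_point 1 0) f = f"
    by (rule poly_mapping_eqI) (simp add: lookup_rescale_vars monomial_value_def torsion_point_def)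
  ultimately show ?thesis by (simp add: decimation_eq)
qed

text \<open>
  Every index below \<open>N M\<close> is \<open>l + M k\<close> for unique \<open>l < M\<close> and \<open>k < N\<close>, and the torsion point of order
  \<open>N M\<close> with index \<open>l + M k\<close> is the product of the one with index \<open>l\<close> and the point of order \<open>N\<close> with
  index \<open>k\<close>.
\<close>

lemma decimation_decimation:
  assumes "N > 0" "M > 0"
  shows "decimation (N * M) f =
         (\<Prod>l\<in>index_cube M. rescale_vars (torsion_point (N * M) l) (decimation N f))"
proof -
  have *: "(\<chi> j. torsion_point (N * M) l $ j * torsion_point N k $ j) =
        torsion_point (N * M) (\<chi> i. l $ i + M * k $ i)" for l k :: "nat ^ 'd"
    using assms by (simp add: torsion_point_def vec_eq_iff field_simps flip: exp_add)
  have "(\<Prod>l\<in>index_cube M. rescale_vars (torsion_point (N * M) l) (decimation N f)) =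
        (\<Prod>(l, k)\<in>index_cube M \<times> index_cube N.
            rescale_vars (torsion_point (N * M) (\<chi> i. l $ i + M * k $ i)) f)"
    by (simp add: decimation_eq rescale_vars_prod rescale_vars_rescale_vars * prod.cartesian_product)
  also have "\<dots> = decimation (N * M) f"
    unfolding decimation_eq
  proof (rule prod.reindex_bij_witness[where
        i = "\<lambda>n. (\<chi> i. n $ i mod M, \<chi> i. n $ i div M)" and
        j = "\<lambda>(l, k). \<chi> i. l $ i + M * k $ i"], goal_cases)
    case (2 x)
    have "l + M * k < N * M" if "l < M" "k < N" for l k
    proof -
      have "l + M * k < M * Suc k" using that by simp
      also have "\<dots> \<le> M * N" using that by (intro mult_le_mono) auto
      finally show ?thesis by (simp add: mult.commute)
    qed
    with 2 show ?case by (auto simp: index_cube_def)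
  qed (use assms in \<open>auto simp: index_cube_def vec_eq_iff less_mult_imp_div_less\<close>)
  finally show ?thesis by simp
qed

lemma exp_eq_1_imp_dvd:
  assumes "exp (2 * of_real pi * \<i> * of_int m / of_nat N) = 1" "N > 0"
  shows "int N dvd m"
proof -
  obtain l :: int where "2 * pi * real_of_int m / real N = real_of_int (2 * l) * pi"
    using assms(1) unfolding exp_eq_1 by auto
  then have "real_of_int m = real_of_int (int N * l)"
    using assms(2) by (simp add: field_simps)
  then show ?thesis by (metis dvd_triv_left of_int_eq_iff)
qed

text \<open>
  Multiplying \<open>x\<^sub>j\<close> by a primitive \<open>N\<close>th root of unity permutes the factors of the decimation
  cyclically. Comparing coefficients of \<open>x\<^sup>n\<close> shows that the \<open>n\<^sub>j\<close>th power of this root is \<open>1\<close>.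
\<close>

lemma keys_decimation_dvd:
  fixes f :: "'d::finite laurent"
  assumes "N > 0" "n \<in> Poly_Mapping.keys (decimation N f)"
  shows "int N dvd n $ j"
proof -
  define e :: "nat ^ 'd" where "e = (\<chi> i. if i = j then 1 else 0)"
  define next_index where "next_index = (\<lambda>k :: nat ^ 'd. \<chi> i. (k $ i + e $ i) mod N)"
  define prev_index where "prev_index = (\<lambda>k :: nat ^ 'd. \<chi> i. (k $ i + (N - e $ i)) mod N)"
  have e: "e $ i \<le> N" for i using assms(1) by (simp add: e_def)
  have period: "exp (2 * of_real pi * \<i> * of_nat (m mod N) / of_nat N) =
        exp (2 * of_real pi * \<i> * of_nat m / of_nat N)" for m
  proof -
    have "(of_nat m :: complex) = of_nat (m mod N) + of_nat N * of_nat (m div N)"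
      by (metis mod_mult_div_eq of_nat_add of_nat_mult)
    then have "2 * of_real pi * \<i> * of_nat m / of_nat N =
        2 * of_real pi * \<i> * of_nat (m mod N) / of_nat N + \<i> * (of_int (int (m div N)) * (of_real pi * 2))"
      using assms(1) by (simp add: field_simps)
    then show ?thesis by (simp only: exp_plus_2pin)
  qed
  have shift: "(\<chi> i. torsion_point N e $ i * torsion_point N k $ i) = torsion_point N (next_index k)" for k
    by (simp add: torsion_point_def next_index_def vec_eq_iff period flip: exp_add)
       (simp add: ring_distribs add_divide_distrib add.commute)
  have "rescale_vars (torsion_point N e) (decimation N f) =
        (\<Prod>k\<in>index_cube N. rescale_vars (torsion_point N (next_index k)) f)"
    by (simp add: decimation_eq rescale_vars_prod rescale_vars_rescale_vars shift)
  also have "\<dots> = decimation N f"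
    unfolding decimation_eq
  proof (rule prod.reindex_bij_witness[where i = prev_index and j = next_index], goal_cases)
    case (1 k)
    have "((a + b) mod N + (N - b)) mod N = a" if "a < N" "b \<le> N" for a b
      using that by (simp only: mod_add_left_eq) simp
    with 1 e show ?case
      by (auto simp: prev_index_def next_index_def index_cube_def vec_eq_iff)
  next
    case (3 k)
    have "((a + (N - b)) mod N + b) mod N = a" if "a < N" "b \<le> N" for a b
      using that by (simp only: mod_add_left_eq) simp
    with 3 e show ?case
      by (auto simp: prev_index_def next_index_def index_cube_def vec_eq_iff)
  qed (use assms(1) in \<open>auto simp: index_cube_def prev_index_def next_index_def\<close>)
  finally have "Poly_Mapping.lookup (decimation N f) n * monomial_value (vec_nth (torsion_point N e)) n =
      Poly_Mapping.lookup (decimation N f) n"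
    by (metis lookup_rescale_vars)
  then have "monomial_value (vec_nth (torsion_point N e)) n = 1"
    using assms(2) by (simp add: in_keys_iff)
  moreover have "monomial_value (vec_nth (torsion_point N e)) n =
      (\<Prod>i\<in>UNIV. if i = j then exp (2 * of_real pi * \<i> * of_int (n $ j) / of_nat N) else 1)"
    unfolding monomial_value_def
    by (intro prod.cong) (auto simp: torsion_point_def e_def exp_power_int field_simps)
  ultimately show ?thesis
    using exp_eq_1_imp_dvd[OF _ assms(1)] by (simp add: prod.delta')
qed

lemma spread_exists: "\<exists>W. spread 1 W f"
proof -
  define B where "B = (\<Sum>n\<in>Poly_Mapping.keys f. \<Sum>j\<in>UNIV. \<bar>n $ j\<bar>)"
  have "\<bar>n $ j\<bar> \<le> B" if "n \<in> Poly_Mapping.keys f" for n j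
  proof -
    have "\<bar>n $ j\<bar> \<le> (\<Sum>j\<in>UNIV. \<bar>n $ j\<bar>)"
      by (rule member_le_sum) auto
    also have "\<dots> \<le> B"
      unfolding B_def by (rule member_le_sum[OF that]) (auto intro: sum_nonneg)
    finally show ?thesis .
  qed
  then have bound: "- B \<le> n $ j" "n $ j \<le> B" if "n \<in> Poly_Mapping.keys f" for n j
    using that by (auto simp: abs_le_iff minus_le_iff)
  have "B \<ge> 0" by (auto simp: B_def intro!: sum_nonneg)
  then have "Poly_Mapping.keys f \<subseteq> lattice_box (\<lambda>_. - B) (nat (2 * B))"
    using bound by (auto simp: lattice_box_def)
  moreover have "(\<lambda>m :: int ^ 'd. int 1 *s m) = id"
    by (simp add: fun_eq_iff vec_eq_iff)
  ultimately show ?thesis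
    unfolding spread_def by (metis image_id id_apply)
qed

lemma spread_rescale_vars:
  "(\<And>j. c $ j \<noteq> 0) \<Longrightarrow> spread N V (rescale_vars c f) \<longleftrightarrow> spread N V f"
  by (simp add: spread_def keys_rescale_vars)

text \<open>
  The lower corner of the new box is the old one divided by \<open>N\<close> and rounded up; the rounding costs
  nothing because all exponents are multiples of \<open>N\<close>.
\<close>

lemma spread_of_multiples:
  assumes "N > 0" "spread 1 (N * V) p" and dvd: "\<And>n j. n \<in> Poly_Mapping.keys p \<Longrightarrow> int N dvd n $ j"
  shows "spread N V p"
proof -
  obtain \<alpha> where \<alpha>: "Poly_Mapping.keys p \<subseteq> (\<lambda>m. int 1 *s m) ` lattice_box \<alpha> (N * V)"
    using assms(2) by (auto simp: spread_def)
  have "n \<in> (\<lambda>m. int N *s m) ` lattice_box (\<lambda>j. - ((- \<alpha> j) div int N)) V"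
    if n: "n \<in> Poly_Mapping.keys p" for n
  proof -
    have \<alpha>': "\<forall>j. \<alpha> j \<le> n $ j \<and> n $ j \<le> \<alpha> j + int N * int V"
      using subsetD[OF \<alpha> n] by (auto simp: lattice_box_def)
    define m where "m = (\<chi> j. n $ j div int N)"
    have nm: "n $ j = int N * m $ j" for j
      using dvd[OF n] by (simp add: m_def)
    have "- ((- \<alpha> j) div int N) \<le> m $ j \<and> m $ j \<le> - ((- \<alpha> j) div int N) + int V" for j
    proof -
      have bd: "\<alpha> j \<le> int N * m $ j" "int N * m $ j \<le> \<alpha> j + int N * int V"
        using \<alpha>'[rule_format, of j] nm[of j] by simp_all
      define q where "q = (- \<alpha> j) div int N"
      have "int N * q + (- \<alpha> j) mod int N = - \<alpha> j" "(- \<alpha> j) mod int N \<ge> 0" "(- \<alpha> j) mod int N < int N"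
        using assms(1) by (auto simp: q_def)
      then have "int N * (- m $ j) < int N * (q + 1)" "int N * q \<le> int N * (int V - m $ j)"
        using bd by (simp_all add: algebra_simps)
      then have "- m $ j < q + 1" "q \<le> int V - m $ j"
        using assms(1) by (simp_all only: mult_less_cancel_left_pos mult_le_cancel_left_pos of_nat_0_less_iff)
      then show ?thesis by (simp add: q_def)
    qed
    moreover have "n = int N *s m" by (simp add: vec_eq_iff nm)
    ultimately show ?thesis by (auto simp: lattice_box_def)
  qed
  then show ?thesis unfolding spread_def by blast
qed

text \<open>
  The decimation has \<open>N\<^sup>d\<close> factors, so its width in \<open>x\<^sub>j\<close> is \<open>N\<^sup>d W\<close>, but in \<open>x\<^sub>j\<^sup>N\<close> only \<open>N\<^sup>d\<^sup>-\<^sup>1 W\<close>. The factor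
  \<open>N\<close> gained here is the source of every error bound of order \<open>1/N\<close> below.
\<close>

lemma spread_decimation:
  fixes f :: "'d::finite laurent"
  assumes "N > 0" "spread 1 W f"
  shows "spread N (N ^ (CARD('d) - 1) * W) (decimation N f)"
proof (rule spread_of_multiples[OF assms(1)])
  have "spread 1 (\<Sum>k\<in>(index_cube N :: (nat ^ 'd) set). W) (decimation N f)"
    unfolding decimation_eq using assms(2) by (intro spread_prod) (simp add: spread_rescale_vars)
  moreover have "N ^ CARD('d) = N * N ^ (CARD('d) - 1)"
    by (metis power_Suc Suc_pred' zero_less_card_finite)
  ultimately show "spread 1 (N * (N ^ (CARD('d) - 1) * W)) (decimation N f)"
    by (simp add: card_index_cube mult.assoc)
qed (use keys_decimation_dvd assms in blast)

lemma decimation_nonzero: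
  assumes "f \<noteq> 0"
  shows "decimation N f \<noteq> 0"
proof -
  obtain W where W: "spread 1 W f" using spread_exists by blast
  have "rescale_vars (torsion_point N k) f \<noteq> 0" for k
    using assms by (simp flip: keys_eq_empty add: keys_rescale_vars)
  then show ?thesis
    unfolding decimation_eq using W
    by (intro prod_laurent_nonzero[where N = 1 and V = "\<lambda>_. W"]) (simp_all add: spread_rescale_vars)
qed

section \<open>The Ronkin function\<close>

definition decimated_height :: "nat \<Rightarrow> 'd::finite laurent \<Rightarrow> real ^ 'd \<Rightarrow> real" where
  "decimated_height N f u = log_height u (decimation N f) / real N ^ CARD('d)"

lemma power_card_bound:
  assumes "N > 0"
  shows "real (N ^ (CARD('d::finite) - 1) * W) / real N ^ CARD('d) = real W / real N"
proof -
  have "real N ^ CARD('d) = real N * real N ^ (CARD('d) - 1)"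
    by (metis power_Suc Suc_pred' zero_less_card_finite)
  then show ?thesis using assms by simp
qed

text \<open>
  The decimation of order \<open>N M\<close> is a product of \<open>M\<^sup>d\<close> polynomials with the same height as the decimation
  of order \<open>N\<close>, each of width \<open>N\<^sup>d\<^sup>-\<^sup>1 W\<close> in the \<open>x\<^sub>j\<^sup>N\<close>. Gelfond's inequality gives an error of \<open>2 d M\<^sup>d N\<^sup>d\<^sup>-\<^sup>1 W\<close>,
  and division by \<open>(N M)\<^sup>d\<close> leaves \<open>2 d W / N\<close>.
\<close>

lemma decimated_height_multiple:
  fixes f :: "'d::finite laurent"
  assumes "f \<noteq> 0"
  shows "\<exists>C\<ge>0. \<forall>N>0. \<forall>M>0. \<forall>u. \<bar>decimated_height (N * M) f u - decimated_height N f u\<bar> \<le> C / real N"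
proof -
  obtain W where W: "spread 1 W f" using spread_exists by blast
  show ?thesis
  proof (intro exI[of _ "2 * real CARD('d) * real W"] conjI allI impI)
    fix N M :: nat and u :: "real ^ 'd"
    assume N: "N > 0" and M: "M > 0"
    define F where "F = decimation N f"
    define V where "V = N ^ (CARD('d) - 1) * W"
    define A where "A = real N ^ CARD('d)"
    define B where "B = real M ^ CARD('d)"
    have AB: "A > 0" "B > 0" using N M by (simp_all add: A_def B_def)
    have "\<bar>(\<Sum>l\<in>(index_cube M :: (nat ^ 'd) set). log_height u (rescale_vars (torsion_point (N * M) l) F))
        - log_height u (\<Prod>l\<in>index_cube M. rescale_vars (torsion_point (N * M) l) F)\<bar>
        \<le> 2 * real CARD('d) * real (\<Sum>l\<in>(index_cube M :: (nat ^ 'd) set). V)"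
    proof (rule gelfond_inequality[OF _ N])
      fix l :: "nat ^ 'd"
      show "rescale_vars (torsion_point (N * M) l) F \<noteq> 0"
        using decimation_nonzero[OF assms, of N] by (simp flip: keys_eq_empty add: keys_rescale_vars F_def)
      show "spread N V (rescale_vars (torsion_point (N * M) l) F)"
        using spread_decimation[OF N W] by (simp add: spread_rescale_vars F_def V_def)
    qed simp
    then have "\<bar>B * log_height u F - log_height u (decimation (N * M) f)\<bar> \<le> 2 * real CARD('d) * (B * real V)"
      by (simp add: log_height_rescale_vars decimation_decimation[OF N M] F_def card_index_cube B_def)
    then have "\<bar>B * log_height u F - log_height u (decimation (N * M) f)\<bar> / (A * B) \<le>
          2 * real CARD('d) * (B * real V) / (A * B)"
      using AB by (intro divide_right_mono) auto
    also have "2 * real CARD('d) * (B * real V) / (A * B) = 2 * real CARD('d) * (real V / A)"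
      using AB by simp
    also have "real V / A = real W / real N"
      unfolding V_def A_def by (rule power_card_bound[OF N])
    also have "\<bar>B * log_height u F - log_height u (decimation (N * M) f)\<bar> / (A * B) =
        \<bar>(B * log_height u F - log_height u (decimation (N * M) f)) / (A * B)\<bar>"
      using AB by (simp add: abs_mult)
    also have "(B * log_height u F - log_height u (decimation (N * M) f)) / (A * B) =
        decimated_height N f u - decimated_height (N * M) f u"
      using AB by (simp add: decimated_height_def F_def A_def B_def field_simps)
    finally show "\<bar>decimated_height (N * M) f u - decimated_height N f u\<bar> \<le> 2 * real CARD('d) * real W / real N"
      by (simp add: abs_minus_commute)
  qed simp
qed

lemma decimated_height_mult:
  fixes f g :: "'d::finite laurent"
  assumes "f \<noteq> 0" "g \<noteq> 0"
  shows "\<exists>C\<ge>0. \<forall>N>0. \<forall>u.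
    \<bar>decimated_height N f u + decimated_height N g u - decimated_height N (f * g) u\<bar> \<le> C / real N"
proof -
  obtain V W where VW: "spread 1 V f" "spread 1 W g" using spread_exists by metis
  show ?thesis
  proof (intro exI[of _ "2 * real CARD('d) * real (V + W)"] conjI allI impI)
    fix N :: nat and u :: "real ^ 'd"
    assume N: "N > 0"
    define A where "A = real N ^ CARD('d)"
    have A: "A > 0" using N by (simp add: A_def)
    define p where "p = (\<lambda>b. decimation N (if b then f else g))"
    have "\<bar>(\<Sum>b\<in>UNIV. log_height u (p b)) - log_height u (\<Prod>b\<in>UNIV. p b)\<bar>
        \<le> 2 * real CARD('d) * real (\<Sum>b\<in>UNIV. N ^ (CARD('d) - 1) * (if b then V else W))"
      using assms spread_decimation[OF N VW(1)] spread_decimation[OF N VW(2)]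
      by (intro gelfond_inequality[OF _ N]) (auto simp: p_def decimation_nonzero)
    then have "\<bar>log_height u (decimation N f) + log_height u (decimation N g) - log_height u (decimation N (f * g))\<bar>
        \<le> 2 * real CARD('d) * real (N ^ (CARD('d) - 1) * (V + W))"
      by (simp add: UNIV_bool p_def decimation_mult algebra_simps)
    then have "\<bar>log_height u (decimation N f) + log_height u (decimation N g) - log_height u (decimation N (f * g))\<bar> / A
        \<le> 2 * real CARD('d) * real (N ^ (CARD('d) - 1) * (V + W)) / A"
      using A by (intro divide_right_mono) auto
    also have "\<dots> = 2 * real CARD('d) * (real (N ^ (CARD('d) - 1) * (V + W)) / A)"
      by simp
    also have "real (N ^ (CARD('d) - 1) * (V + W)) / A = real (V + W) / real N"
      unfolding A_def by (rule power_card_bound[OF N])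
    also have "\<bar>log_height u (decimation N f) + log_height u (decimation N g) - log_height u (decimation N (f * g))\<bar> / A =
      \<bar>decimated_height N f u + decimated_height N g u - decimated_height N (f * g) u\<bar>"
      using A unfolding decimated_height_def A_def[symmetric] add_divide_distrib[symmetric] diff_divide_distrib[symmetric]
      by (simp add: abs_mult)
    finally show "\<bar>decimated_height N f u + decimated_height N g u - decimated_height N (f * g) u\<bar>
        \<le> 2 * real CARD('d) * real (V + W) / real N"
      by simp
  qed simp
qed

text \<open>
  The limit equals the Ronkin function of \<open>f\<close>, the mean of \<open>log \<bar>f\<bar>\<close> over the torus of radii \<open>exp (u $ j)\<close>.
\<close>

definition ronkin :: "'d::finite laurent \<Rightarrow> real ^ 'd \<Rightarrow> real" where
  "ronkin f u = lim (\<lambda>N. decimated_height N f u)"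

text \<open>
  Orders \<open>N\<close> and \<open>M\<close> are compared through their common multiple \<open>N M\<close>.
\<close>

lemma decimated_height_ronkin:
  fixes f :: "'d::finite laurent"
  assumes "f \<noteq> 0"
  shows "\<exists>C\<ge>0. \<forall>N>0. \<forall>u. \<bar>decimated_height N f u - ronkin f u\<bar> \<le> C / real N"
    and "(\<lambda>N. decimated_height N f u) \<longlonglongrightarrow> ronkin f u"
proof -
  obtain C where C: "C \<ge> 0" "\<And>N M u. N > 0 \<Longrightarrow> M > 0 \<Longrightarrow>
      \<bar>decimated_height (N * M) f u - decimated_height N f u\<bar> \<le> C / real N"
    using decimated_height_multiple[OF assms] by blast
  have diff: "\<bar>decimated_height N f u - decimated_height M f u\<bar> \<le> C / real N + C / real M"
    if "N > 0" "M > 0" for N M u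
    using C(2)[OF that, of u] C(2)[OF that(2,1), of u] unfolding mult.commute[of M N] by linarith
  have lim0: "(\<lambda>N. C / real N) \<longlonglongrightarrow> 0"
    by (rule lim_const_over_n)
  have conv: "(\<lambda>N. decimated_height N f u) \<longlonglongrightarrow> ronkin f u" for u
  proof -
    have "Cauchy (\<lambda>N. decimated_height N f u)"
    proof (rule CauchyI)
      fix e :: real assume "e > 0"
      then have "eventually (\<lambda>N. C / real N < e / 2) sequentially"
        using order_tendstoD(2)[OF lim0, of "e / 2"] by simp
      then obtain K where K: "\<And>N. N \<ge> K \<Longrightarrow> C / real N < e / 2"
        by (auto simp: eventually_sequentially)
      show "\<exists>K. \<forall>m\<ge>K. \<forall>n\<ge>K. norm (decimated_height m f u - decimated_height n f u) < e"
      proof (intro exI[of _ "Suc K"] allI impI)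
        fix m n assume mn: "Suc K \<le> m" "Suc K \<le> n"
        then show "norm (decimated_height m f u - decimated_height n f u) < e"
          using diff[of m n u] K[of m] K[of n] unfolding real_norm_def by linarith
      qed
    qed
    then have "convergent (\<lambda>N. decimated_height N f u)"
      by (simp add: Cauchy_convergent_iff)
    then show ?thesis
      unfolding ronkin_def by (rule convergent_LIMSEQ_iff[THEN iffD1])
  qed
  then show "(\<lambda>N. decimated_height N f u) \<longlonglongrightarrow> ronkin f u" .
  have "\<bar>decimated_height N f u - ronkin f u\<bar> \<le> C / real N" if "N > 0" for N u
  proof (rule tendsto_le[OF sequentially_bot])
    show "(\<lambda>M. \<bar>decimated_height N f u - decimated_height M f u\<bar>) \<longlonglongrightarrow> \<bar>decimated_height N f u - ronkin f u\<bar>"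
      by (intro tendsto_intros conv)
    show "(\<lambda>M. C / real N + C / real M) \<longlonglongrightarrow> C / real N"
      using tendsto_add[OF tendsto_const lim0, of "C / real N"] by simp
    show "\<forall>\<^sub>F M in sequentially. \<bar>decimated_height N f u - decimated_height M f u\<bar> \<le> C / real N + C / real M"
      using eventually_gt_at_top[of 0] by eventually_elim (rule diff[OF that])
  qed
  with C(1) show "\<exists>C\<ge>0. \<forall>N>0. \<forall>u. \<bar>decimated_height N f u - ronkin f u\<bar> \<le> C / real N" by blast
qed

lemma ronkin_mult:
  assumes "f \<noteq> 0" "g \<noteq> 0" "f * g \<noteq> 0"
  shows "ronkin (f * g) u = ronkin f u + ronkin g u"
proof -
  obtain C where C: "\<And>N. N > 0 \<Longrightarrow>
    \<bar>decimated_height N f u + decimated_height N g u - decimated_height N (f * g) u\<bar> \<le> C / real N"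
    using decimated_height_mult[OF assms(1,2)] by blast
  have "(\<lambda>N. decimated_height N f u + decimated_height N g u - decimated_height N (f * g) u)
      \<longlonglongrightarrow> ronkin f u + ronkin g u - ronkin (f * g) u"
    by (intro tendsto_intros decimated_height_ronkin assms)
  moreover have "(\<lambda>N. decimated_height N f u + decimated_height N g u - decimated_height N (f * g) u) \<longlonglongrightarrow> 0"
  proof (rule Lim_null_comparison)
    show "\<forall>\<^sub>F N in sequentially. norm (decimated_height N f u + decimated_height N g u
        - decimated_height N (f * g) u) \<le> C / real N"
      using eventually_gt_at_top[of 0] by eventually_elim (simp add: C)
  qed (rule lim_const_over_n)
  ultimately show ?thesis
    using LIMSEQ_unique by fastforce
qed

section \<open>Convex duality for finite point sets\<close>

text \<open>
  The least \<open>b\<close> for which the affine function \<open>s \<mapsto> a \<bullet> s + b\<close> lies on or above all points of \<open>P\<close>.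
\<close>

definition upper_support :: "('a::real_inner \<times> real) set \<Rightarrow> 'a \<Rightarrow> real" where
  "upper_support P a = Max ((\<lambda>(s, t). t - a \<bullet> s) ` P)"

lemma upper_support_ge_hull:
  assumes "finite P" "(s, t) \<in> convex hull P"
  shows "t \<le> upper_support P a + a \<bullet> s"
proof -
  have "P \<subseteq> {x. (- a, 1) \<bullet> x \<le> upper_support P a}"
  proof
    fix x assume "x \<in> P"
    then have "(case x of (s, t) \<Rightarrow> t - a \<bullet> s) \<le> upper_support P a"
      unfolding upper_support_def using assms(1) by (intro Max_ge) auto
    then show "x \<in> {x. (- a, 1) \<bullet> x \<le> upper_support P a}"
      by (cases x) simp
  qed
  then have "convex hull P \<subseteq> {x. (- a, 1) \<bullet> x \<le> upper_support P a}"
    by (intro hull_minimal convex_halfspace_le)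
  with assms(2) have "(s, t) \<in> {x. (- a, 1) \<bullet> x \<le> upper_support P a}"
    by blast
  then show ?thesis by simp
qed

lemma upper_support_attained:
  assumes "finite P" "P \<noteq> {}"
  obtains s t where "(s, t) \<in> P" "upper_support P a = t - a \<bullet> s"
proof -
  have "upper_support P a \<in> (\<lambda>(s, t). t - a \<bullet> s) ` P"
    unfolding upper_support_def using assms by (intro Max_in) auto
  then show ?thesis using that by auto
qed

text \<open>
  If \<open>(r, t0)\<close> lies below every affine function whose graph is above the Minkowski sum of \<open>P\<close> and \<open>Q\<close>, then
  some point \<open>(r, t)\<close> with \<open>t \<ge> t0\<close> belongs to the convex hull of this sum. That hull is
  the sum of the two hulls, and the two summands of \<open>(r, t)\<close> give the splitting. Otherwise the upward ray
  from \<open>(r, t0)\<close> could be strictly separated from the compact hull. The separating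
  hyperplane may be vertical, but by compactness it can be tilted slightly and then
  is the graph of an affine function contradicting the assumption.
\<close>

lemma split_upper_support_sum:
  fixes P Q :: "('a::euclidean_space \<times> real) set"
  assumes P: "finite P" "P \<noteq> {}" and Q: "finite Q" "Q \<noteq> {}"
    and below: "\<And>a. t0 < upper_support P a + upper_support Q a + a \<bullet> r"
  shows "\<exists>s t1 t2. t0 \<le> t1 + t2 \<and> (\<forall>a. t1 \<le> upper_support P a + a \<bullet> s)
           \<and> (\<forall>a. t2 \<le> upper_support Q a + a \<bullet> (r - s))"
proof -
  define K where "K = {x + y |x y. x \<in> convex hull P \<and> y \<in> convex hull Q}"
  define ray where "ray = {x :: 'a \<times> real. fst x = r \<and> t0 \<le> snd x}"
  have K: "compact K" "convex K" "K \<noteq> {}"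
  proof -
    show "compact K" unfolding K_def
      using P Q by (intro compact_sums compact_convex_hull finite_imp_compact)
    have "K = (\<Union>x\<in>convex hull P. \<Union>y\<in>convex hull Q. {x + y})"
      unfolding K_def by blast
    then show "convex K"
      by (simp add: convex_sums)
    obtain x y where "x \<in> P" "y \<in> Q" using P Q by blast
    then have "x + y \<in> K"
      unfolding K_def by (blast intro: hull_inc)
    then show "K \<noteq> {}" by blast
  qed
  have ray: "closed ray" "convex ray"
  proof -
    have "ray = {r} \<times> {t0..}" by (auto simp: ray_def)
    then show "closed ray" "convex ray"
      by (auto intro!: closed_Times convex_Times)
  qed
  have "K \<inter> ray \<noteq> {}"
  proof
    assume "K \<inter> ray = {}"
    then obtain v b where v: "\<And>x. x \<in> K \<Longrightarrow> v \<bullet> x < b" "\<And>x. x \<in> ray \<Longrightarrow> v \<bullet> x > b"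
      using separating_hyperplane_compact_closed[OF K(2,1,3) ray(2,1)] by blast
    obtain w l where vw: "v = (w, l)" by (cases v)
    have vK: "w \<bullet> s + l * t < b" if "(s, t) \<in> K" for s t
      using v(1)[OF that] by (simp add: vw)
    have vray: "w \<bullet> r + l * t > b" if "t \<ge> t0" for t
      using v(2)[of "(r, t)"] that by (simp add: vw ray_def)
    \<comment> \<open>The functional is bounded below on an upward ray.\<close>
    have l: "l \<ge> 0"
    proof (rule ccontr)
      assume "\<not> l \<ge> 0"
      define t where "t = max t0 ((b - w \<bullet> r) / l)"
      have "t \<ge> (b - w \<bullet> r) / l" by (simp add: t_def)
      then have "l * t \<le> b - w \<bullet> r"
        using \<open>\<not> l \<ge> 0\<close> by (simp add: field_simps)
      with vray[of t] show False by (simp add: t_def)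
    qed
    obtain B where B: "\<And>x. x \<in> K \<Longrightarrow> norm x \<le> B"
      using compact_imp_bounded[OF K(1)] by (auto simp: bounded_iff)
    have B': "\<bar>t\<bar> \<le> B" if "(s, t) \<in> K" for s t
      using B[OF that] norm_snd_le[of t s] by simp
    have "B \<ge> 0" using B K(3) norm_ge_zero order_trans by blast
    \<comment> \<open>The slope \<open>l\<close> in the last coordinate is raised by \<open>e\<close>, so small that the tilt uses up less than the gap.\<close>
    define gap where "gap = w \<bullet> r + l * t0 - b"
    define e where "e = gap / (B + \<bar>t0\<bar> + 1)"
    have gap: "gap > 0" using vray[of t0] by (simp add: gap_def)
    have e: "e > 0" "e * (B + \<bar>t0\<bar> + 1) = gap"
      using gap \<open>B \<ge> 0\<close> by (simp_all add: e_def)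
    have el: "l + e > 0" using e l by simp
    define a where "a = (- 1 / (l + e)) *\<^sub>R w"
    obtain s1 t1 where p1: "(s1, t1) \<in> P" "upper_support P a = t1 - a \<bullet> s1"
      using upper_support_attained[OF P] .
    obtain s2 t2 where p2: "(s2, t2) \<in> Q" "upper_support Q a = t2 - a \<bullet> s2"
      using upper_support_attained[OF Q] .
    have "(s1 + s2, t1 + t2) \<in> K"
      unfolding K_def using hull_inc[OF p1(1)] hull_inc[OF p2(1)] by force
    note vK[OF this] B'[OF this]
    moreover have "e * (t1 + t2) \<le> e * B" "e * (- t0) \<le> e * \<bar>t0\<bar>"
      using B'[OF \<open>(s1 + s2, t1 + t2) \<in> K\<close>] e(1) by (intro mult_left_mono; simp)+
    ultimately have "w \<bullet> (s1 + s2) + (l + e) * (t1 + t2) < w \<bullet> r + (l + e) * t0"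
      using e gap unfolding gap_def by (simp add: algebra_simps)
    then have "(l + e) * (t1 + t2 - t0) < w \<bullet> r - w \<bullet> (s1 + s2)"
      by (simp add: algebra_simps)
    then have "t1 + t2 - t0 < (w \<bullet> r - w \<bullet> (s1 + s2)) / (l + e)"
      using el by (simp add: pos_less_divide_eq mult.commute)
    also have "\<dots> = a \<bullet> (s1 + s2) - a \<bullet> r"
      by (simp add: a_def diff_divide_distrib)
    finally have "upper_support P a + upper_support Q a + a \<bullet> r < t0"
      by (simp add: p1 p2 inner_add_right)
    with below[of a] show False by simp
  qed
  then obtain x y where xy: "x \<in> convex hull P" "y \<in> convex hull Q" "x + y \<in> ray"
    unfolding K_def by blast
  obtain s1 t1 s2 t2 where
    st: "(s1, t1) \<in> convex hull P" "(s2, t2) \<in> convex hull Q" "s1 + s2 = r" "t0 \<le> t1 + t2"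
    using xy that[of "fst x" "snd x" "fst y" "snd y"] by (simp add: ray_def)
  have "s2 = r - s1" using st(3) by (simp add: algebra_simps)
  then show ?thesis
    using st(4) upper_support_ge_hull[OF P(1) st(1)] upper_support_ge_hull[OF Q(1) st(2)]
    by blast
qed

section \<open>The decimation limit as a Legendre dual\<close>

lemma coeff_real_real_vec: "coeff_real F (real_vec n) = Poly_Mapping.lookup F n"
proof -
  have "(\<chi> i. \<lfloor>real_vec n $ i\<rfloor>) = n" by (simp add: real_vec_def vec_eq_iff)
  then show ?thesis by (simp add: coeff_real_def) (simp add: real_vec_def)
qed

lemma coeff_real_nonzeroE:
  assumes "coeff_real F r \<noteq> 0"
  obtains n where "n \<in> Poly_Mapping.keys F" "r = real_vec n"
proof -
  have r: "\<forall>i. r $ i \<in> \<int>" "Poly_Mapping.lookup F (\<chi> i. \<lfloor>r $ i\<rfloor>) \<noteq> 0"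
    using assms by (auto simp: coeff_real_def split: if_splits)
  then have "r = real_vec (\<chi> i. \<lfloor>r $ i\<rfloor>)"
    by (simp add: real_vec_def vec_eq_iff)
  with r(2) show ?thesis using that by (auto simp: in_keys_iff)
qed

definition log_coeff_points :: "nat \<Rightarrow> 'd::finite laurent \<Rightarrow> ((real ^ 'd) \<times> real) set" where
  "log_coeff_points N f =
     (\<lambda>n. ((1 / real N ^ CARD('d)) *\<^sub>R real_vec n,
           ln (cmod (Poly_Mapping.lookup (decimation N f) n)) / real N ^ CARD('d)))
       ` Poly_Mapping.keys (decimation N f)"

lemma log_coeff_points_finite_nonempty:
  assumes "f \<noteq> 0"
  shows "finite (log_coeff_points N f)" "log_coeff_points N f \<noteq> {}"
  using decimation_nonzero[OF assms] by (auto simp: log_coeff_points_def)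

lemma decimated_height_eq_upper_support:
  fixes f :: "'d::finite laurent"
  assumes "f \<noteq> 0" "N > 0"
  shows "decimated_height N f (- a) = upper_support (log_coeff_points N f) a"
proof -
  define F where "F = decimation N f"
  define A where "A = real N ^ CARD('d)"
  have A: "A > 0" using assms(2) by (simp add: A_def)
  let ?h = "\<lambda>n. ln (cmod (Poly_Mapping.lookup F n)) + (- a) \<bullet> real_vec n"
  have "F \<noteq> 0" using assms(1) by (simp add: F_def decimation_nonzero)
  then have "Max (?h ` Poly_Mapping.keys F) / A = Max ((\<lambda>x. x / A) ` ?h ` Poly_Mapping.keys F)"
    using A by (intro mono_Max_commute) (auto intro!: monoI divide_right_mono)
  also have "(\<lambda>x. x / A) ` ?h ` Poly_Mapping.keys F = (\<lambda>(s, t). t - a \<bullet> s) ` log_coeff_points N f"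
    unfolding log_coeff_points_def F_def[symmetric] A_def[symmetric] image_image
    by (intro image_cong) (auto simp: diff_divide_distrib)
  finally show ?thesis
    by (simp add: decimated_height_def log_height_def upper_support_def F_def A_def)
qed

text \<open>
  The function takes the value \<open>-\<infinity>\<close> except at the finitely many scaled exponents of the decimation, so only
  these constrain a dominating affine function.
\<close>

lemma decimation_log_le_affine_iff:
  fixes f :: "'d::finite laurent"
  assumes "f \<noteq> 0" "N > 0"
  shows "(\<forall>s. decimation_log N f s \<le> ereal (a \<bullet> s + b)) \<longleftrightarrow> decimated_height N f (- a) \<le> b"
proof -
  define F where "F = decimation N f"
  define A where "A = real N ^ CARD('d)"
  have A: "A > 0" using assms(2) by (simp add: A_def)
  have log: "decimation_log N f s = ereal (1 / A) * log_norm (coeff_real F (A *\<^sub>R s))" for s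
    by (simp add: decimation_log_def A_def F_def)
  have "decimated_height N f (- a) \<le> b \<longleftrightarrow> (\<forall>x\<in>log_coeff_points N f. (case x of (s, t) \<Rightarrow> t - a \<bullet> s) \<le> b)"
    unfolding decimated_height_eq_upper_support[OF assms] upper_support_def
    using log_coeff_points_finite_nonempty[OF assms(1)] by (subst Max_le_iff) auto
  also have "\<dots> \<longleftrightarrow> (\<forall>n\<in>Poly_Mapping.keys F.
      ln (cmod (Poly_Mapping.lookup F n)) / A \<le> a \<bullet> ((1 / A) *\<^sub>R real_vec n) + b)"
    unfolding log_coeff_points_def F_def[symmetric] A_def[symmetric] ball_simps prod.case
    by (simp add: algebra_simps)
  also have "\<dots> \<longleftrightarrow> (\<forall>s. decimation_log N f s \<le> ereal (a \<bullet> s + b))"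
  proof (intro iffI allI ballI)
    fix s assume *: "\<forall>n\<in>Poly_Mapping.keys F.
      ln (cmod (Poly_Mapping.lookup F n)) / A \<le> a \<bullet> ((1 / A) *\<^sub>R real_vec n) + b"
    show "decimation_log N f s \<le> ereal (a \<bullet> s + b)"
    proof (cases "coeff_real F (A *\<^sub>R s) = 0")
      case True
      then show ?thesis using A by (simp add: log log_norm_def)
    next
      case False
      then obtain n where n: "n \<in> Poly_Mapping.keys F" "A *\<^sub>R s = real_vec n"
        by (rule coeff_real_nonzeroE)
      have "s = (1 / A) *\<^sub>R real_vec n"
        using A by (simp flip: n(2))
      with * n(1) have "ln (cmod (Poly_Mapping.lookup F n)) / A \<le> a \<bullet> s + b"
        by blast
      then show ?thesis
        using n(1) by (simp add: log n(2) coeff_real_real_vec log_norm_def in_keys_iff)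
    qed
  next
    fix n assume *: "\<forall>s. decimation_log N f s \<le> ereal (a \<bullet> s + b)" and n: "n \<in> Poly_Mapping.keys F"
    have "A *\<^sub>R (1 / A) *\<^sub>R real_vec n = real_vec n"
      using A by simp
    with *[rule_format, of "(1 / A) *\<^sub>R real_vec n"] n
    show "ln (cmod (Poly_Mapping.lookup F n)) / A \<le> a \<bullet> ((1 / A) *\<^sub>R real_vec n) + b"
      by (simp add: log coeff_real_real_vec log_norm_def in_keys_iff)
  qed
  finally show ?thesis by simp
qed

text \<open>
  For each slope \<open>a\<close> the best dominating affine function has the constant term
  \<open>decimated_height N f (- a)\<close>.
\<close>

lemma concave_hull_decimation_log:
  assumes "f \<noteq> 0" "N > 0"
  shows "concave_hull (decimation_log N f) r = (INF a. ereal (decimated_height N f (- a) + a \<bullet> r))"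
  unfolding concave_hull_def decimation_log_le_affine_iff[OF assms]
proof (rule antisym)
  show "(INF (a, b)\<in>{(a, b). decimated_height N f (- a) \<le> b}. ereal (a \<bullet> r + b))
      \<le> (INF a. ereal (decimated_height N f (- a) + a \<bullet> r))"
    by (intro INF_greatest INF_lower2[of "(_, decimated_height N f (- _))"]) (auto simp: add.commute)
  show "(INF a. ereal (decimated_height N f (- a) + a \<bullet> r))
      \<le> (INF (a, b)\<in>{(a, b). decimated_height N f (- a) \<le> b}. ereal (a \<bullet> r + b))"
  proof (rule INF_greatest, clarify)
    fix a b assume "decimated_height N f (- a) \<le> b"
    then show "(INF a. ereal (decimated_height N f (- a) + a \<bullet> r)) \<le> ereal (a \<bullet> r + b)"
      by (intro INF_lower2[of a]) auto
  qed
qed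

definition ronkin_dual :: "'d::finite laurent \<Rightarrow> real ^ 'd \<Rightarrow> ereal" where
  "ronkin_dual f r = (INF a. ereal (ronkin f (- a) + a \<bullet> r))"

lemma INF_ereal_shift_le:
  fixes x y :: "'a \<Rightarrow> real"
  assumes "\<And>a. x a \<le> y a + c"
  shows "(INF a. ereal (x a)) \<le> (INF a. ereal (y a)) + ereal c"
proof -
  have "(INF a. ereal (x a)) - ereal c \<le> (INF a. ereal (y a))"
  proof (rule INF_greatest)
    fix a
    have "(INF a. ereal (x a)) - ereal c \<le> ereal (x a) - ereal c"
      by (intro ereal_minus_mono INF_lower) auto
    also have "\<dots> \<le> ereal (y a)"
      using assms[of a] by simp
    finally show "(INF a. ereal (x a)) - ereal c \<le> ereal (y a)" .
  qed
  then show ?thesis by (simp add: ereal_minus_le)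
qed

text \<open>
  The decimated heights converge uniformly in \<open>u\<close>, and an infimum changes by at most the uniform error.
  The same estimate covers the points at which the limit is \<open>-\<infinity>\<close>.
\<close>

lemma concave_hull_tendsto_ronkin_dual:
  assumes "f \<noteq> 0"
  shows "(\<lambda>N. concave_hull (decimation_log N f) r) \<longlonglongrightarrow> ronkin_dual f r"
proof -
  obtain C where C: "C \<ge> 0" "\<And>N u. N > 0 \<Longrightarrow> \<bar>decimated_height N f u - ronkin f u\<bar> \<le> C / real N"
    using decimated_height_ronkin(1)[OF assms] by blast
  have upper: "concave_hull (decimation_log N f) r \<le> ronkin_dual f r + ereal (C / real N)"
    and lower: "ronkin_dual f r \<le> concave_hull (decimation_log N f) r + ereal (C / real N)" if "N > 0" for N
  proof -
    show "concave_hull (decimation_log N f) r \<le> ronkin_dual f r + ereal (C / real N)"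
      unfolding concave_hull_decimation_log[OF assms that] ronkin_dual_def
    proof (rule INF_ereal_shift_le)
      fix a show "decimated_height N f (- a) + a \<bullet> r \<le> ronkin f (- a) + a \<bullet> r + C / real N"
        using C(2)[OF that, of "- a"] by linarith
    qed
    show "ronkin_dual f r \<le> concave_hull (decimation_log N f) r + ereal (C / real N)"
      unfolding concave_hull_decimation_log[OF assms that] ronkin_dual_def
    proof (rule INF_ereal_shift_le)
      fix a show "ronkin f (- a) + a \<bullet> r \<le> decimated_height N f (- a) + a \<bullet> r + C / real N"
        using C(2)[OF that, of "- a"] by linarith
    qed
  qed
  have lim0: "(\<lambda>N. ereal (c / real N)) \<longlonglongrightarrow> ereal 0" for c
    by (intro tendsto_ereal lim_const_over_n)
  show ?thesis
  proof (rule tendsto_sandwich)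
    show "\<forall>\<^sub>F N in sequentially. ronkin_dual f r + ereal (- C / real N) \<le> concave_hull (decimation_log N f) r"
      using eventually_gt_at_top[of 0]
    proof eventually_elim
      case (elim N)
      then have "ronkin_dual f r - ereal (C / real N) \<le> concave_hull (decimation_log N f) r"
        using lower by (simp add: ereal_minus_le)
      then show ?case by (simp add: minus_ereal_def)
    qed
    show "\<forall>\<^sub>F N in sequentially. concave_hull (decimation_log N f) r \<le> ronkin_dual f r + ereal (C / real N)"
      using eventually_gt_at_top[of 0] by eventually_elim (rule upper)
    have lim: "(\<lambda>N. ronkin_dual f r + ereal (c / real N)) \<longlonglongrightarrow> ronkin_dual f r + ereal 0" for c
      by (intro tendsto_add_ereal_general tendsto_const lim0) auto
    from lim[of "- C"] lim[of C] show "(\<lambda>N. ronkin_dual f r + ereal (- C / real N)) \<longlonglongrightarrow> ronkin_dual f r"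
      "(\<lambda>N. ronkin_dual f r + ereal (C / real N)) \<longlonglongrightarrow> ronkin_dual f r"
      by simp_all
  qed
qed

text \<open>
  At level \<open>1\<close> the height of \<open>f\<close> differs from its Ronkin function by a bounded amount, and moving the slope
  to infinity along the normal of a hyperplane that separates \<open>r\<close> from the polytope makes
  the corresponding dominating affine function tend to \<open>-\<infinity>\<close> at \<open>r\<close>.
\<close>

lemma ronkin_dual_outside_newton_polytope:
  fixes f :: "'d::finite laurent"
  assumes "f \<noteq> 0" "r \<notin> newton_polytope f"
  shows "ronkin_dual f r = -\<infinity>"
proof -
  have np: "newton_polytope f = convex hull (real_vec ` Poly_Mapping.keys f)"
    by (simp add: newton_polytope_def real_vec_def)
  then have "convex (newton_polytope f)" "closed (newton_polytope f)"
    by (simp_all add: compact_imp_closed compact_convex_hull finite_imp_compact)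
  from separating_hyperplane_closed_point[OF this assms(2)]
  obtain v b where v: "v \<bullet> r < b" "\<And>x. x \<in> newton_polytope f \<Longrightarrow> v \<bullet> x > b"
    by blast
  obtain C where "\<And>N u. N > 0 \<Longrightarrow> \<bar>decimated_height N f u - ronkin f u\<bar> \<le> C / real N"
    using decimated_height_ronkin(1)[OF assms(1)] by blast
  from this[of 1] have C: "\<bar>log_height u f - ronkin f u\<bar> \<le> C" for u
    by (simp add: decimated_height_def decimation_1[simplified])
  have "ronkin_dual f r \<le> ereal y" for y
  proof -
    define t where "t = max 0 ((log_height 0 f + C - y) / (b - v \<bullet> r))"
    have "t \<ge> 0" by (simp add: t_def)
    have t: "log_height 0 f + C - y \<le> t * (b - v \<bullet> r)"
    proof -
      have "(log_height 0 f + C - y) / (b - v \<bullet> r) \<le> t" by (simp add: t_def)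
      with v(1) show ?thesis by (simp add: pos_divide_le_eq)
    qed
    obtain n where n: "n \<in> Poly_Mapping.keys f"
      "log_height (- (t *\<^sub>R v)) f = ln (cmod (Poly_Mapping.lookup f n)) + (- (t *\<^sub>R v)) \<bullet> real_vec n"
      using log_height_attained[OF assms(1)] .
    have "b < v \<bullet> real_vec n"
      using n(1) by (intro v(2)) (auto simp: np intro: hull_inc)
    then have "t * b \<le> t * (v \<bullet> real_vec n)"
      using \<open>t \<ge> 0\<close> by (intro mult_left_mono) auto
    moreover have "ln (cmod (Poly_Mapping.lookup f n)) \<le> log_height 0 f"
      using log_height_ge[OF n(1), of 0] by simp
    ultimately have "log_height (- (t *\<^sub>R v)) f + (t *\<^sub>R v) \<bullet> r \<le> y - C"
      using t by (simp add: n(2) algebra_simps)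
    moreover have "ronkin f (- (t *\<^sub>R v)) \<le> log_height (- (t *\<^sub>R v)) f + C"
      using C[of "- (t *\<^sub>R v)"] by (simp add: abs_le_iff)
    ultimately have "ronkin f (- (t *\<^sub>R v)) + (t *\<^sub>R v) \<bullet> r \<le> y" by linarith
    then show ?thesis
      unfolding ronkin_dual_def by (intro INF_lower2[of "t *\<^sub>R v"]) auto
  qed
  then show ?thesis
    by (intro ereal_bot) blast
qed

lemma decimation_limit_eq_ronkin_dual:
  assumes "f \<noteq> 0"
  shows "decimation_limit f r = ronkin_dual f r"
  using limI[OF concave_hull_tendsto_ronkin_dual[OF assms]] ronkin_dual_outside_newton_polytope[OF assms]
  by (simp add: decimation_limit_def)

section \<open>Tropical convolution\<close>

lemma laurent_mult_nonzero:
  fixes f g :: "'d::finite laurent"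
  assumes "f \<noteq> 0" "g \<noteq> 0"
  shows "f * g \<noteq> 0"
proof -
  obtain V W where "spread 1 V f" "spread 1 W g" using spread_exists by metis
  then have "(\<Prod>b\<in>UNIV. if b then f else g) \<noteq> 0"
    using assms
    by (intro prod_laurent_nonzero[where N = 1 and V = "\<lambda>b. if b then V else W"]) auto
  then show ?thesis by (simp add: UNIV_bool mult.commute)
qed

lemma ronkin_dual_mult_ge:
  assumes "f \<noteq> 0" "g \<noteq> 0"
  shows "ronkin_dual f s + ronkin_dual g (r - s) \<le> ronkin_dual (f * g) r"
  unfolding ronkin_dual_def[of "f * g"]
proof (rule INF_greatest)
  fix a
  have "ronkin_dual f s + ronkin_dual g (r - s)
      \<le> ereal (ronkin f (- a) + a \<bullet> s) + ereal (ronkin g (- a) + a \<bullet> (r - s))"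
    unfolding ronkin_dual_def by (intro add_mono INF_lower) auto
  also have "\<dots> = ereal (ronkin (f * g) (- a) + a \<bullet> r)"
    by (simp add: ronkin_mult assms laurent_mult_nonzero inner_diff_right)
  finally show "ronkin_dual f s + ronkin_dual g (r - s) \<le> ereal (ronkin (f * g) (- a) + a \<bullet> r)" .
qed

text \<open>
  The splitting is found for the point sets of order \<open>N\<close>, with \<open>N\<close> so large that replacing Ronkin functions by
  decimated heights costs at most \<open>e / 2\<close>, once before and once after the splitting.
\<close>

lemma ronkin_dual_mult_split:
  fixes f g :: "'d::finite laurent"
  assumes "f \<noteq> 0" "g \<noteq> 0" "ereal y < ronkin_dual (f * g) r" "e > 0"
  shows "\<exists>s. ereal (y - e) \<le> ronkin_dual f s + ronkin_dual g (r - s)"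
proof -
  obtain C where C: "\<And>N u. N > 0 \<Longrightarrow> \<bar>decimated_height N f u - ronkin f u\<bar> \<le> C / real N"
    using decimated_height_ronkin(1)[OF assms(1)] by blast
  obtain D where D: "\<And>N u. N > 0 \<Longrightarrow> \<bar>decimated_height N g u - ronkin g u\<bar> \<le> D / real N"
    using decimated_height_ronkin(1)[OF assms(2)] by blast
  have "eventually (\<lambda>N. (C + D) / real N < e / 2) sequentially"
    using order_tendstoD(2)[OF lim_const_over_n[of "C + D"], of "e / 2"] assms(4) by simp
  then have "eventually (\<lambda>N. N > 0 \<and> (C + D) / real N < e / 2) sequentially"
    using eventually_gt_at_top[of 0] by eventually_elim simp
  then obtain N where N: "N > 0" "(C + D) / real N < e / 2"
    using eventually_happens'[OF sequentially_bot] by blast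
  have err: "\<bar>decimated_height N f u - ronkin f u\<bar> + \<bar>decimated_height N g u - ronkin g u\<bar> \<le> e / 2"
    and errf: "decimated_height N f u \<le> ronkin f u + C / real N"
    and errg: "decimated_height N g u \<le> ronkin g u + D / real N" for u
    using C[OF N(1), of u] D[OF N(1), of u] N(2) unfolding add_divide_distrib by linarith+
  let ?P = "log_coeff_points N f" and ?Q = "log_coeff_points N g"
  have below: "y - e / 2 < upper_support ?P a + upper_support ?Q a + a \<bullet> r" for a
  proof -
    have "ereal y < ereal (ronkin (f * g) (- a) + a \<bullet> r)"
      using assms(3) by (rule less_le_trans) (auto simp: ronkin_dual_def intro: INF_lower)
    then have "y < ronkin f (- a) + ronkin g (- a) + a \<bullet> r"
      by (simp add: ronkin_mult assms laurent_mult_nonzero)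
    with err[of "- a"] show ?thesis
      unfolding decimated_height_eq_upper_support[OF assms(1) N(1), symmetric]
        decimated_height_eq_upper_support[OF assms(2) N(1), symmetric]
      by linarith
  qed
  obtain s t1 t2 where s: "y - e / 2 \<le> t1 + t2"
    "\<And>a. t1 \<le> upper_support ?P a + a \<bullet> s" "\<And>a. t2 \<le> upper_support ?Q a + a \<bullet> (r - s)"
    using split_upper_support_sum[OF log_coeff_points_finite_nonempty[OF assms(1)]
        log_coeff_points_finite_nonempty[OF assms(2)] below] by metis
  have "ereal (t1 - C / real N) \<le> ronkin_dual f s"
    unfolding ronkin_dual_def
  proof (rule INF_greatest)
    fix a show "ereal (t1 - C / real N) \<le> ereal (ronkin f (- a) + a \<bullet> s)"
      using s(2)[of a] errf[of "- a"] by (simp add: decimated_height_eq_upper_support[OF assms(1) N(1)])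
  qed
  moreover have "ereal (t2 - D / real N) \<le> ronkin_dual g (r - s)"
    unfolding ronkin_dual_def
  proof (rule INF_greatest)
    fix a show "ereal (t2 - D / real N) \<le> ereal (ronkin g (- a) + a \<bullet> (r - s))"
      using s(3)[of a] errg[of "- a"] by (simp add: decimated_height_eq_upper_support[OF assms(2) N(1)])
  qed
  ultimately have "ereal (t1 - C / real N) + ereal (t2 - D / real N) \<le> ronkin_dual f s + ronkin_dual g (r - s)"
    by (rule add_mono)
  moreover have "y - e \<le> (t1 - C / real N) + (t2 - D / real N)"
    using s(1) N(2) by (simp add: add_divide_distrib)
  ultimately show ?thesis
    by (metis ereal_less_eq(3) order_trans plus_ereal.simps(1))
qed

theorem corollary1p4:
  fixes f g :: "'d::finite laurent"
  assumes "f \<noteq> 0" and "g \<noteq> 0"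
  shows "decimation_limit (f * g) = decimation_limit f \<circledast> decimation_limit g"
proof
  fix r
  have "ronkin_dual (f * g) r = (SUP s. ronkin_dual f s + ronkin_dual g (r - s))"
  proof (rule antisym)
    show "(SUP s. ronkin_dual f s + ronkin_dual g (r - s)) \<le> ronkin_dual (f * g) r"
      by (intro SUP_least ronkin_dual_mult_ge assms)
    show "ronkin_dual (f * g) r \<le> (SUP s. ronkin_dual f s + ronkin_dual g (r - s))"
    proof (rule dense_le)
      fix x assume x: "x < ronkin_dual (f * g) r"
      show "x \<le> (SUP s. ronkin_dual f s + ronkin_dual g (r - s))"
      proof (rule ereal_le_epsilon2)
        fix e :: real assume "e > 0"
        show "x \<le> (SUP s. ronkin_dual f s + ronkin_dual g (r - s)) + ereal e"
        proof (cases x)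
          case (real y)
          obtain s where "ereal (y - e) \<le> ronkin_dual f s + ronkin_dual g (r - s)"
            using ronkin_dual_mult_split[OF assms x[unfolded real] \<open>e > 0\<close>] by blast
          then have "ereal (y - e) \<le> (SUP s. ronkin_dual f s + ronkin_dual g (r - s))"
            by (rule SUP_upper2[OF UNIV_I])
          then have "ereal (y - e) + ereal e \<le> (SUP s. ronkin_dual f s + ronkin_dual g (r - s)) + ereal e"
            by (rule add_right_mono)
          then show ?thesis by (simp add: real)
        qed (use x in auto)
      qed
    qed
  qed
  then show "decimation_limit (f * g) r = (decimation_limit f \<circledast> decimation_limit g) r"
    by (simp add: tropical_conv_def decimation_limit_eq_ronkin_dual assms laurent_mult_nonzero)
qed

end
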